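(* Let $\Gamma=(V,E,s,r)$ be an arbitrary directed graph and let $S$ be a semifield. Then the Leavitt path algebra $L_S(\Gamma)$ is ideal-simple if and only if the graph $\Gamma$ satisfies the following two conditions: (1) the only hereditary and saturated subsets of $V$ are $\varnothing$ and $V$; (2) every cycle in $\Gamma$ has an exit.
   Context: Semirings. A hemiring $(R,+,\cdot,0)$ is a set such that $(R,+,0)$ is a commutative monoid, $(R,\cdot)$ is a semigroup, multiplication distributes over addition from either side, and $0x=0=x0$ for all $x\in R$. A semiring is a hemiring with a multiplicative identity $1$; it is commutative if its multiplication is. A semifield is a commutative semiring $S$ such that $(S\setminus\{0\},\cdot,1)$ is a group. An ideal of a hemiring $R$ is a submonoid $I$ of $(R,+,0)$ with $xa, ax\in I$ for all $a\in I$, $x\in R$. A hemiring $R$ is ideal-simple if $0$ and $R$ are its only ideals. An $S$-algebra over a commutative semiring $S$ is an $S$-semimodule with an associative $S$-bilinear multiplication (not necessarily unital). Graphs. A directed graph $\Gamma=(V,E,s,r)$ consists of disjoint sets $V$ (vertices) and $E$ (edges) and maps $s,r:E\to V$ (source, range). A vertex $v$ is regular if $0<|s^{-1}(v)|<\infty$. A path is a sequence of edges $p=e_1\dots e_n$ with $r(e_i)=s(e_{i+1})$; put $s(p)=s(e_1)$, $r(p)=r(e_n)$; vertices are paths of length $0$. A cycle is a path $e_1\dots e_n$ ($n\ge 1$) with $s(e_1)=r(e_n)$ and $s(e_1),\dots,s(e_n)$ pairwise distinct. An exit for a path $e_1\dots e_n$ is an edge $f$ with $s(f)=s(e_i)$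 and $f\ne e_i$ for some $1\le i\le n$. A subset $H\subseteq V$ is hereditary if $s(e)\in H$ implies $r(e)\in H$ for all $e\in E$, and saturated if $v\in H$ for every regular vertex $v$ with $r(s^{-1}(v))\subseteq H$. Leavitt path algebra. For a commutative semiring $S$, $L_S(\Gamma)$ is the $S$-algebra presented by generators $V\cup E\cup E^*$, where $E\to E^*$, $e\mapsto e^*$, is a bijection and $V,E,E^*$ are pairwise disjoint, and relations: (1) $vv'=\delta_{v,v'}v$ for $v,v'\in V$; (2) $s(e)e=e=e\,r(e)$ and $r(e)e^*=e^*=e^*s(e)$ for $e\in E$; (3) $e^*f=\delta_{e,f}r(e)$ for $e,f\in E$; (4) $v=\sum_{e\in s^{-1}(v)}ee^*$ for every regular vertex $v$. *)

theory Defs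
  imports "Graph_Theory.Arc_Walk"
begin

section \<open>Hemirings, ideals, semifields and algebras\<close>

record 'a hemiring =
  carrier :: "'a set"
  add :: "'a \<Rightarrow> 'a \<Rightarrow> 'a" (infixl "\<oplus>\<index>" 65)
  mul :: "'a \<Rightarrow> 'a \<Rightarrow> 'a" (infixl "\<otimes>\<index>" 70)
  zero :: 'a ("\<zero>\<index>")

locale hemiring =
  fixes R :: "('a, 'm) hemiring_scheme" (structure)
  assumes add_closed: "x \<in> carrier R \<Longrightarrow> y \<in> carrier R \<Longrightarrow> x \<oplus> y \<in> carrier R"
    and mul_closed: "x \<in> carrier R \<Longrightarrow> y \<in> carrier R \<Longrightarrow> x \<otimes> y \<in> carrier R"
    and zero_closed: "\<zero> \<in> carrier R"
    and add_assoc: "x \<in> carrier R \<Longrightarrow> y \<in> carrier R \<Longrightarrow> z \<in> carrier R \<Longrightarrow>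
      (x \<oplus> y) \<oplus> z = x \<oplus> (y \<oplus> z)"
    and add_commute: "x \<in> carrier R \<Longrightarrow> y \<in> carrier R \<Longrightarrow> x \<oplus> y = y \<oplus> x"
    and add_zero: "x \<in> carrier R \<Longrightarrow> \<zero> \<oplus> x = x"
    and mul_assoc: "x \<in> carrier R \<Longrightarrow> y \<in> carrier R \<Longrightarrow> z \<in> carrier R \<Longrightarrow>
      (x \<otimes> y) \<otimes> z = x \<otimes> (y \<otimes> z)"
    and distrib_right: "x \<in> carrier R \<Longrightarrow> y \<in> carrier R \<Longrightarrow> z \<in> carrier R \<Longrightarrow>
      (x \<oplus> y) \<otimes> z = x \<otimes> z \<oplus> y \<otimes> z"
    and distrib_left: "x \<in> carrier R \<Longrightarrow> y \<in> carrier R \<Longrightarrow> z \<in> carrier R \<Longrightarrow>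
      x \<otimes> (y \<oplus> z) = x \<otimes> y \<oplus> x \<otimes> z"
    and zero_mul: "x \<in> carrier R \<Longrightarrow> \<zero> \<otimes> x = \<zero>"
    and mul_zero: "x \<in> carrier R \<Longrightarrow> x \<otimes> \<zero> = \<zero>"

definition ideal :: "'a set \<Rightarrow> ('a, 'm) hemiring_scheme \<Rightarrow> bool" where
  "ideal I R \<longleftrightarrow> I \<subseteq> carrier R \<and> zero R \<in> I
     \<and> (\<forall>a\<in>I. \<forall>b\<in>I. add R a b \<in> I)
     \<and> (\<forall>a\<in>I. \<forall>x\<in>carrier R. mul R x a \<in> I \<and> mul R a x \<in> I)"

text \<open>As in the literal definition, the zero hemiring counts as ideal-simple.\<close>

definition ideal_simple :: "('a, 'm) hemiring_scheme \<Rightarrow> bool" where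
  "ideal_simple R \<longleftrightarrow> {I. ideal I R} = {{zero R}, carrier R}"

text \<open>
  \<^class>\<open>comm_semiring_1\<close> includes \<open>0 \<noteq> 1\<close>; together with invertibility of the nonzero elements
  this makes the nonzero elements closed under multiplication, hence a group.
\<close>

class semifield = comm_semiring_1 +
  assumes nonzero_invertible: "a \<noteq> 0 \<Longrightarrow> \<exists>b. a * b = 1"

lemma (in semifield) mult_nonzero:
  assumes "a \<noteq> 0" "b \<noteq> 0" shows "a * b \<noteq> 0"
proof
  assume "a * b = 0"
  moreover obtain c where "a * c = 1" using nonzero_invertible assms(1) by blast
  ultimately have "b = 0" by (metis mult.commute mult.left_commute mult_1_right mult_zero_right)
  with assms(2) show False by simp
qed

record ('s, 'a) algebra = "'a hemiring" +
  smult :: "'s \<Rightarrow> 'a \<Rightarrow> 'a" (infixr "\<odot>\<index>" 75)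

locale algebra = hemiring A
  for A :: "('s::comm_semiring_1, 'a, 'm) algebra_scheme" (structure) +
  assumes smult_closed: "x \<in> carrier A \<Longrightarrow> k \<odot> x \<in> carrier A"
    and smult_add: "x \<in> carrier A \<Longrightarrow> y \<in> carrier A \<Longrightarrow> k \<odot> (x \<oplus> y) = k \<odot> x \<oplus> k \<odot> y"
    and add_smult: "x \<in> carrier A \<Longrightarrow> (k + l) \<odot> x = k \<odot> x \<oplus> l \<odot> x"
    and smult_smult: "x \<in> carrier A \<Longrightarrow> (k * l) \<odot> x = k \<odot> (l \<odot> x)"
    and one_smult: "x \<in> carrier A \<Longrightarrow> 1 \<odot> x = x"
    and zero_smult: "x \<in> carrier A \<Longrightarrow> 0 \<odot> x = \<zero>"
    and smult_zero: "k \<odot> \<zero> = \<zero>"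
    and smult_mul_left: "x \<in> carrier A \<Longrightarrow> y \<in> carrier A \<Longrightarrow> (k \<odot> x) \<otimes> y = k \<odot> (x \<otimes> y)"
    and smult_mul_right: "x \<in> carrier A \<Longrightarrow> y \<in> carrier A \<Longrightarrow> x \<otimes> (k \<odot> y) = k \<odot> (x \<otimes> y)"


section \<open>Algebras presented by generators and relations\<close>

text \<open>
  The algebra presented by generators \<open>X\<close> and relations \<open>\<R>\<close> consists of the formal algebra
  expressions over \<open>X\<close> modulo the least congruence containing all instances of the axioms of a
  (non-unital, associative) algebra and the relations in \<open>\<R>\<close>.
\<close>

datatype (dead 's, gens: 'x) alg_term =
    Gen 'x
  | Zero
  | Plus "('s, 'x) alg_term" "('s, 'x) alg_term"
  | Times "('s, 'x) alg_term" "('s, 'x) alg_term"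
  | Scale 's "('s, 'x) alg_term"

definition alg_terms :: "'x set \<Rightarrow> ('s, 'x) alg_term set" where
  "alg_terms X = {t. gens t \<subseteq> X}"

inductive_set alg_axioms ::
    "(('s::comm_semiring_1, 'x) alg_term \<times> ('s, 'x) alg_term) set" where
  "(Plus (Plus t u) w, Plus t (Plus u w)) \<in> alg_axioms"
| "(Plus t u, Plus u t) \<in> alg_axioms"
| "(Plus Zero t, t) \<in> alg_axioms"
| "(Times (Times t u) w, Times t (Times u w)) \<in> alg_axioms"
| "(Times (Plus t u) w, Plus (Times t w) (Times u w)) \<in> alg_axioms"
| "(Times t (Plus u w), Plus (Times t u) (Times t w)) \<in> alg_axioms"
| "(Times Zero t, Zero) \<in> alg_axioms"
| "(Times t Zero, Zero) \<in> alg_axioms"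
| "(Scale k (Plus t u), Plus (Scale k t) (Scale k u)) \<in> alg_axioms"
| "(Scale (k + l) t, Plus (Scale k t) (Scale l t)) \<in> alg_axioms"
| "(Scale (k * l) t, Scale k (Scale l t)) \<in> alg_axioms"
| "(Scale 1 t, t) \<in> alg_axioms"
| "(Scale 0 t, Zero) \<in> alg_axioms"
| "(Scale k Zero, Zero) \<in> alg_axioms"
| "(Times (Scale k t) u, Scale k (Times t u)) \<in> alg_axioms"
| "(Times t (Scale k u), Scale k (Times t u)) \<in> alg_axioms"

inductive_set alg_cong ::
    "'x set \<Rightarrow> (('s::comm_semiring_1, 'x) alg_term \<times> ('s, 'x) alg_term) set
     \<Rightarrow> (('s, 'x) alg_term \<times> ('s, 'x) alg_term) set"
  for X \<R> where
  base: "(t, u) \<in> alg_axioms \<union> \<R> \<Longrightarrow> t \<in> alg_terms X \<Longrightarrow> u \<in> alg_terms X \<Longrightarrow> (t, u) \<in> alg_cong X \<R>"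
| refl: "t \<in> alg_terms X \<Longrightarrow> (t, t) \<in> alg_cong X \<R>"
| sym: "(t, u) \<in> alg_cong X \<R> \<Longrightarrow> (u, t) \<in> alg_cong X \<R>"
| trans: "(t, u) \<in> alg_cong X \<R> \<Longrightarrow> (u, w) \<in> alg_cong X \<R> \<Longrightarrow> (t, w) \<in> alg_cong X \<R>"
| plus: "(t, t') \<in> alg_cong X \<R> \<Longrightarrow> (u, u') \<in> alg_cong X \<R> \<Longrightarrow> (Plus t u, Plus t' u') \<in> alg_cong X \<R>"
| times: "(t, t') \<in> alg_cong X \<R> \<Longrightarrow> (u, u') \<in> alg_cong X \<R> \<Longrightarrow> (Times t u, Times t' u') \<in> alg_cong X \<R>"
| scale: "(t, t') \<in> alg_cong X \<R> \<Longrightarrow> (Scale k t, Scale k t') \<in> alg_cong X \<R>"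

definition presented_algebra ::
    "'x set \<Rightarrow> (('s::comm_semiring_1, 'x) alg_term \<times> ('s, 'x) alg_term) set
     \<Rightarrow> ('s, ('s, 'x) alg_term set) algebra" where
  "presented_algebra X \<R> =
    \<lparr> carrier = alg_terms X // alg_cong X \<R>,
      add = (\<lambda>A B. \<Union>t\<in>A. \<Union>u\<in>B. alg_cong X \<R> `` {Plus t u}),
      mul = (\<lambda>A B. \<Union>t\<in>A. \<Union>u\<in>B. alg_cong X \<R> `` {Times t u}),
      zero = alg_cong X \<R> `` {Zero},
      smult = (\<lambda>k A. \<Union>t\<in>A. alg_cong X \<R> `` {Scale k t}) \<rparr>"

lemma alg_terms_simps [simp]:
  "Gen x \<in> alg_terms X \<longleftrightarrow> x \<in> X"
  "Zero \<in> alg_terms X"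
  "Plus t u \<in> alg_terms X \<longleftrightarrow> t \<in> alg_terms X \<and> u \<in> alg_terms X"
  "Times t u \<in> alg_terms X \<longleftrightarrow> t \<in> alg_terms X \<and> u \<in> alg_terms X"
  "Scale k t \<in> alg_terms X \<longleftrightarrow> t \<in> alg_terms X"
  by (auto simp: alg_terms_def)

lemma alg_cong_in_terms:
  "(t, u) \<in> alg_cong X \<R> \<Longrightarrow> t \<in> alg_terms X \<and> u \<in> alg_terms X"
  by (induction rule: alg_cong.induct) auto

lemma equiv_alg_cong: "equiv (alg_terms X) (alg_cong X \<R>)"
  by (rule equivI)
    (auto simp: refl_on_def dest: alg_cong_in_terms
       intro: alg_cong.refl intro!: symI transI intro: alg_cong.sym alg_cong.trans)

lemma alg_class_eq_iff:
  assumes "t \<in> alg_terms X" "u \<in> alg_terms X"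
  shows "alg_cong X \<R> `` {t} = alg_cong X \<R> `` {u} \<longleftrightarrow> (t, u) \<in> alg_cong X \<R>"
  using eq_equiv_class_iff[OF equiv_alg_cong assms] .

lemma presented_algebra_simps:
  fixes X :: "'x set" and \<R> :: "(('s::comm_semiring_1, 'x) alg_term \<times> ('s, 'x) alg_term) set"
  defines "P \<equiv> presented_algebra X \<R>" and "c \<equiv> \<lambda>t. alg_cong X \<R> `` {t}"
  shows "carrier P = c ` alg_terms X"
    and "zero P = c Zero"
    and "t \<in> alg_terms X \<Longrightarrow> u \<in> alg_terms X \<Longrightarrow> add P (c t) (c u) = c (Plus t u)"
    and "t \<in> alg_terms X \<Longrightarrow> u \<in> alg_terms X \<Longrightarrow> mul P (c t) (c u) = c (Times t u)"
    and "t \<in> alg_terms X \<Longrightarrow> smult P k (c t) = c (Scale k t)"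
proof -
  note eq = equiv_class_eq[OF equiv_alg_cong]
  show "carrier P = c ` alg_terms X"
    by (auto simp: P_def c_def presented_algebra_def quotient_def)
  show "zero P = c Zero" by (simp add: P_def c_def presented_algebra_def)
  { fix t u :: "('s, 'x) alg_term" assume tu: "t \<in> alg_terms X" "u \<in> alg_terms X"
    have self: "t \<in> c t" "u \<in> c u" using tu by (simp_all add: c_def alg_cong.refl)
    have *: "c (Plus t' u') = c (Plus t u)" "c (Times t' u') = c (Times t u)"
      if "t' \<in> c t" "u' \<in> c u" for t' u'
    proof -
      have "(t', t) \<in> alg_cong X \<R>" "(u', u) \<in> alg_cong X \<R>"
        using that by (simp_all add: c_def alg_cong.sym)
      then show "c (Plus t' u') = c (Plus t u)" "c (Times t' u') = c (Times t u)"
        unfolding c_def by (rule eq[OF alg_cong.plus] eq[OF alg_cong.times])+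
    qed
    have "add P (c t) (c u) = (\<Union>t'\<in>c t. \<Union>u'\<in>c u. c (Plus t' u'))"
      "mul P (c t) (c u) = (\<Union>t'\<in>c t. \<Union>u'\<in>c u. c (Times t' u'))"
      by (simp_all add: P_def c_def presented_algebra_def)
    moreover have "(\<Union>t'\<in>c t. \<Union>u'\<in>c u. c (Plus t' u')) = (\<Union>t'\<in>c t. \<Union>u'\<in>c u. c (Plus t u))"
      "(\<Union>t'\<in>c t. \<Union>u'\<in>c u. c (Times t' u')) = (\<Union>t'\<in>c t. \<Union>u'\<in>c u. c (Times t u))"
      by (intro SUP_cong HOL.refl *; assumption)+
    moreover have "(\<Union>t'\<in>c t. \<Union>u'\<in>c u. A) = A" for A :: "('s, 'x) alg_term set"
      using self by blast
    ultimately show "add P (c t) (c u) = c (Plus t u)" "mul P (c t) (c u) = c (Times t u)"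
      by (simp_all only:) }
  { fix t :: "('s, 'x) alg_term" and k assume t: "t \<in> alg_terms X"
    have self: "t \<in> c t" using t by (simp add: c_def alg_cong.refl)
    have *: "c (Scale k t') = c (Scale k t)" if "t' \<in> c t" for t'
      unfolding c_def using that by (intro eq alg_cong.scale) (simp add: c_def alg_cong.sym)
    have "smult P k (c t) = (\<Union>t'\<in>c t. c (Scale k t'))"
      by (simp add: P_def c_def presented_algebra_def)
    also have "\<dots> = (\<Union>t'\<in>c t. c (Scale k t))"
      by (intro SUP_cong HOL.refl *; assumption)
    finally show "smult P k (c t) = c (Scale k t)"
      using self by auto }
qed

lemma algebra_presented_algebra: "algebra (presented_algebra X \<R>)"
proof -
  have ax: "alg_cong X \<R> `` {t} = alg_cong X \<R> `` {u}"
    if "(t, u) \<in> alg_axioms" "t \<in> alg_terms X" "u \<in> alg_terms X" for t u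
    using that by (simp add: alg_class_eq_iff alg_cong.base)
  show ?thesis
    by unfold_locales
      (auto simp: presented_algebra_simps simp del: Image_singleton_iff del: equalityI
        intro!: imageI alg_axioms.intros[THEN ax])
qed

text \<open>
  The universal property: an assignment of the generators in an algebra \<open>A\<close> that satisfies the
  relations induces a well-defined map on the presented algebra.
\<close>

primrec alg_eval :: "('s, 'a, 'm) algebra_scheme \<Rightarrow> ('x \<Rightarrow> 'a) \<Rightarrow> ('s, 'x) alg_term \<Rightarrow> 'a" where
  "alg_eval A f (Gen x) = f x"
| "alg_eval A f Zero = zero A"
| "alg_eval A f (Plus t u) = add A (alg_eval A f t) (alg_eval A f u)"
| "alg_eval A f (Times t u) = mul A (alg_eval A f t) (alg_eval A f u)"
| "alg_eval A f (Scale k t) = smult A k (alg_eval A f t)"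

lemma (in algebra) alg_eval_closed:
  assumes "f ` X \<subseteq> carrier A" "t \<in> alg_terms X"
  shows "alg_eval A f t \<in> carrier A"
  using assms(2,1)
  by (induction t) (auto intro: add_closed mul_closed zero_closed smult_closed)

lemma (in algebra) alg_eval_cong:
  assumes "f ` X \<subseteq> carrier A"
    and "\<And>t u. (t, u) \<in> \<R> \<Longrightarrow> t \<in> alg_terms X \<Longrightarrow> u \<in> alg_terms X \<Longrightarrow>
      alg_eval A f t = alg_eval A f u"
    and "(t, u) \<in> alg_cong X \<R>"
  shows "alg_eval A f t = alg_eval A f u"
  using assms(3)
proof (induction rule: alg_cong.induct)
  case (base t u)
  note closed = alg_eval_closed[OF assms(1)]
  from base(1) show ?case
  proof
    assume "(t, u) \<in> alg_axioms"
    then show ?thesis using base(2,3)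
      by (cases rule: alg_axioms.cases)
        (simp_all add: closed add_assoc add_zero mul_assoc distrib_right distrib_left zero_mul
          mul_zero smult_add add_smult smult_smult one_smult zero_smult smult_zero
          smult_mul_left smult_mul_right add_commute)
  qed (use base assms(2) in auto)
qed simp_all


section \<open>Graphs\<close>

text \<open>
  A directed graph is a \<^locale>\<open>wf_digraph\<close>, with \<open>tail\<close> the source and \<open>head\<close> the range map;
  vertex and arc sets may be infinite, and loops and parallel arcs are allowed.
\<close>

definition regular_vertex :: "('v, 'e) pre_digraph \<Rightarrow> 'v \<Rightarrow> bool" where
  "regular_vertex G v \<longleftrightarrow> v \<in> verts G \<and> finite (out_arcs G v) \<and> out_arcs G v \<noteq> {}"

definition hereditary :: "('v, 'e) pre_digraph \<Rightarrow> 'v set \<Rightarrow> bool" where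
  "hereditary G H \<longleftrightarrow> (\<forall>e\<in>arcs G. tail G e \<in> H \<longrightarrow> head G e \<in> H)"

definition saturated :: "('v, 'e) pre_digraph \<Rightarrow> 'v set \<Rightarrow> bool" where
  "saturated G H \<longleftrightarrow> (\<forall>v. regular_vertex G v \<and> head G ` out_arcs G v \<subseteq> H \<longrightarrow> v \<in> H)"

definition has_exit :: "('v, 'e) pre_digraph \<Rightarrow> 'e list \<Rightarrow> bool" where
  "has_exit G p \<longleftrightarrow> (\<exists>f\<in>arcs G. \<exists>e\<in>set p. tail G f = tail G e \<and> f \<noteq> e)"

text \<open>
  The library's \<^const>\<open>pre_digraph.cycle\<close> asks for distinct ranges, which for a closed path is
  the same as distinct sources.
\<close>

lemma (in wf_digraph) cycle_iff_distinct_tails: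
  "cycle p \<longleftrightarrow> p \<noteq> [] \<and> set p \<subseteq> arcs G
     \<and> (\<forall>i. Suc i < length p \<longrightarrow> head G (p ! i) = tail G (p ! Suc i))
     \<and> tail G (hd p) = head G (last p) \<and> distinct (map (tail G) p)"
proof -
  have cas: "cas u p v \<longleftrightarrow> tail G (hd p) = u \<and> head G (last p) = v
      \<and> (\<forall>i. Suc i < length p \<longrightarrow> head G (p ! i) = tail G (p ! Suc i))"
    if "p \<noteq> []" for u p v
    using that
  proof (induction p arbitrary: u rule: list_nonempty_induct)
    case (cons e p)
    have "(\<forall>i. Suc i < length (e # p) \<longrightarrow> head G ((e # p) ! i) = tail G ((e # p) ! Suc i)) \<longleftrightarrow>
        head G e = tail G (hd p)
        \<and> (\<forall>i. Suc i < length p \<longrightarrow> head G (p ! i) = tail G (p ! Suc i))" (is "?L \<longleftrightarrow> ?R")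
    proof
      assume L: ?L
      show ?R using spec[OF L, of 0] spec[OF L, of "Suc _"] cons.hyps
        by (auto simp: hd_conv_nth)
    next
      assume ?R
      then show ?L using cons.hyps by (auto simp: hd_conv_nth nth_Cons split: nat.splits)
    qed
    then show ?case using cons by auto
  qed auto
  have d: "distinct (tl (awalk_verts u p)) \<longleftrightarrow> distinct (map (tail G) p)"
    if "p \<noteq> []" "tail G (hd p) = head G (last p)" for u
    using that by (cases p) (auto simp: awalk_verts_conv)
  have "head G (last p) \<in> verts G" if "p \<noteq> []" "set p \<subseteq> arcs G"
    using that last_in_set[of p] by (meson head_in_verts subsetD)
  then show ?thesis
    by (cases "p = []") (auto simp: cycle_def awalk_def cas d)
qed


section \<open>The Leavitt path algebra\<close>

datatype ('v, 'e) leavitt_gen = Vertex 'v | Edge 'e | Ghost 'e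

definition leavitt_gens :: "('v, 'e) pre_digraph \<Rightarrow> ('v, 'e) leavitt_gen set" where
  "leavitt_gens G = Vertex ` verts G \<union> Edge ` arcs G \<union> Ghost ` arcs G"

text \<open>
  Formal sums have to be written in some order; the last relation is imposed for every
  enumeration \<open>es\<close> of the arcs leaving a regular vertex, all of which are equivalent.
\<close>

inductive_set leavitt_relations ::
    "('v, 'e) pre_digraph
     \<Rightarrow> (('s, ('v, 'e) leavitt_gen) alg_term \<times> ('s, ('v, 'e) leavitt_gen) alg_term) set"
  for G where
  vertex_vertex: "v \<in> verts G \<Longrightarrow> w \<in> verts G \<Longrightarrow>
    (Times (Gen (Vertex v)) (Gen (Vertex w)), if v = w then Gen (Vertex v) else Zero)
      \<in> leavitt_relations G"
| source_edge: "e \<in> arcs G \<Longrightarrow>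
    (Times (Gen (Vertex (tail G e))) (Gen (Edge e)), Gen (Edge e)) \<in> leavitt_relations G"
| edge_range: "e \<in> arcs G \<Longrightarrow>
    (Times (Gen (Edge e)) (Gen (Vertex (head G e))), Gen (Edge e)) \<in> leavitt_relations G"
| range_ghost: "e \<in> arcs G \<Longrightarrow>
    (Times (Gen (Vertex (head G e))) (Gen (Ghost e)), Gen (Ghost e)) \<in> leavitt_relations G"
| ghost_source: "e \<in> arcs G \<Longrightarrow>
    (Times (Gen (Ghost e)) (Gen (Vertex (tail G e))), Gen (Ghost e)) \<in> leavitt_relations G"
| ghost_edge: "e \<in> arcs G \<Longrightarrow> f \<in> arcs G \<Longrightarrow>
    (Times (Gen (Ghost e)) (Gen (Edge f)), if e = f then Gen (Vertex (head G e)) else Zero)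
      \<in> leavitt_relations G"
| regular: "regular_vertex G v \<Longrightarrow> distinct es \<Longrightarrow> set es = out_arcs G v \<Longrightarrow>
    (Gen (Vertex v),
     foldr (\<lambda>e t. Plus (Times (Gen (Edge e)) (Gen (Ghost e))) t) es Zero)
      \<in> leavitt_relations G"

definition leavitt_path_algebra ::
    "'s::comm_semiring_1 itself \<Rightarrow> ('v, 'e) pre_digraph
     \<Rightarrow> ('s, ('s, ('v, 'e) leavitt_gen) alg_term set) algebra" where
  "leavitt_path_algebra _ G = presented_algebra (leavitt_gens G) (leavitt_relations G)"

end

theory Submission
  imports Defs
begin

text \<open>
  \<^bold>\<open>Sufficiency.\<close> The vertices contained in an ideal form a hereditary saturated set, and an ideal
  that contains all vertices is everything. So it is enough to find one vertex in every nonzero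
  ideal \<open>I\<close>. The algebra is spanned by the monomials \<open>p q\<^sup>*\<close> with paths \<open>p\<close>, \<open>q\<close> that end at the same
  vertex, and the search proceeds in three steps.

  \<^item> Multiplication by edges on the right shortens the ghost parts \<open>q\<^sup>*\<close>. A nonzero element of \<open>I\<close>
    thus leads to a combination of distinct paths with nonzero coefficients in \<open>I\<close>
    (\<open>vert_in_nonzero_ideal\<close>). The delicate point is an infinite emitter, where an edge that does not
    occur in the element removes all ghosts at once.
  \<^item> Multiplying such a combination by \<open>p\<^sup>*\<close> on the left, for a shortest path \<open>p\<close> in it, gives
    \<open>k v + \<Sum>\<^sub>i k\<^sub>i t\<^sub>i\<close> with \<open>k \<noteq> 0\<close> and closed paths \<open>t\<^sub>i\<close> at \<open>v\<close> (\<open>vert_of_path_combination\<close>).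
  \<^item> Every closed path contains a cycle and hence has an exit. If \<open>\<mu>\<close> follows \<open>t\<^sub>1\<close> up to an exit and
    then leaves, then \<open>\<mu>\<^sup>* t\<^sub>1 \<mu> = 0\<close>, while \<open>\<mu>\<^sup>* v \<mu>\<close> is a vertex and the other terms keep their form
    (\<open>vert_of_vert_plus_closed_paths\<close>). After finitely many such steps only a multiple of a vertex is
    left, and its coefficient is invertible.

  No subtraction occurs, so semifields are as good as fields here.

  \<^bold>\<open>Necessity.\<close> Both parts rest on explicit representations of the algebra by partial permutations of
  coordinates (locale \<open>branching\<close>), one for every hereditary saturated set \<open>H\<close>. The representation for
  \<open>H\<close> kills exactly the vertices in \<open>H\<close>. For \<open>H = \<emptyset>\<close> it shows that vertices are nonzero, and for
  \<open>H\<close> other than \<open>\<emptyset>\<close> and \<open>V\<close> its kernel is then a proper nonzero ideal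
  (\<open>not_ideal_simple_if_nontrivial\<close>). For a cycle \<open>c\<close> of length \<open>n\<close> at \<open>v\<close> without exit the kernel does
  not help. The expected ideal is generated by \<open>v + c\<close>, and over a semiring, where \<open>-1\<close> may not exist,
  this ideal need not be the kernel of anything. Instead the representation for \<open>H = \<emptyset>\<close> is graded, so
  that its operators become matrices of Laurent polynomials, with \<open>v\<close> and \<open>c\<close> acting on the coordinates
  at \<open>v\<close> as \<open>1\<close> and \<open>x\<^sup>n\<close>. The elements all of whose matrix entries are multiples of \<open>1 + x\<^sup>n\<close> form an
  ideal containing \<open>v + c\<close> but not \<open>v\<close>, because a multiple of \<open>1 + x\<^sup>n\<close> is never a nonzero monomial
  (\<open>not_ideal_simple_if_cycle_without_exit\<close>).
\<close>

section \<open>Finite sums in a hemiring\<close>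

context hemiring
begin

definition list_sum :: "('x \<Rightarrow> 'a) \<Rightarrow> 'x list \<Rightarrow> 'a" where
  "list_sum f xs = foldr (\<lambda>x s. f x \<oplus> s) xs \<zero>"

lemma list_sum_simps [simp]:
  "list_sum f [] = \<zero>"
  "list_sum f (x # xs) = f x \<oplus> list_sum f xs"
  by (simp_all add: list_sum_def)

lemmas closed [simp, intro] = add_closed mul_closed zero_closed

lemma zero_add [simp]: "x \<in> carrier R \<Longrightarrow> \<zero> \<oplus> x = x"
  and add_zero_right [simp]: "x \<in> carrier R \<Longrightarrow> x \<oplus> \<zero> = x"
  by (metis add_zero, metis add_zero add_commute zero_closed)

lemma add_left_commute:
  "x \<in> carrier R \<Longrightarrow> y \<in> carrier R \<Longrightarrow> z \<in> carrier R \<Longrightarrow> x \<oplus> (y \<oplus> z) = y \<oplus> (x \<oplus> z)"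
  by (metis add_assoc add_commute)

lemma list_sum_closed [simp, intro]:
  "(\<And>x. x \<in> set xs \<Longrightarrow> f x \<in> carrier R) \<Longrightarrow> list_sum f xs \<in> carrier R"
  by (induction xs) auto

lemma list_sum_cong:
  "(\<And>x. x \<in> set xs \<Longrightarrow> f x = g x) \<Longrightarrow> list_sum f xs = list_sum g xs"
  by (induction xs) auto

lemma mul_list_sum:
  assumes "y \<in> carrier R" "\<And>x. x \<in> set xs \<Longrightarrow> f x \<in> carrier R"
  shows "y \<otimes> list_sum f xs = list_sum (\<lambda>x. y \<otimes> f x) xs"
  using assms(2) by (induction xs) (auto simp: assms(1) mul_zero distrib_left)

lemma list_sum_mul:
  assumes "y \<in> carrier R" "\<And>x. x \<in> set xs \<Longrightarrow> f x \<in> carrier R"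
  shows "list_sum f xs \<otimes> y = list_sum (\<lambda>x. f x \<otimes> y) xs"
  using assms(2) by (induction xs) (auto simp: assms(1) zero_mul distrib_right)

lemma list_sum_append:
  assumes "\<And>x. x \<in> set (xs @ ys) \<Longrightarrow> f x \<in> carrier R"
  shows "list_sum f (xs @ ys) = list_sum f xs \<oplus> list_sum f ys"
  using assms by (induction xs) (auto simp: add_assoc)

lemma list_sum_zero: "(\<And>x. x \<in> set xs \<Longrightarrow> f x = \<zero>) \<Longrightarrow> list_sum f xs = \<zero>"
  by (induction xs) auto

lemma list_sum_filter:
  assumes "\<And>x. x \<in> set xs \<Longrightarrow> f x \<in> carrier R" "\<And>x. x \<in> set xs \<Longrightarrow> \<not> P x \<Longrightarrow> f x = \<zero>"
  shows "list_sum f (filter P xs) = list_sum f xs"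
  using assms by (induction xs) auto

lemma list_sum_map: "list_sum f (map g xs) = list_sum (\<lambda>x. f (g x)) xs"
  by (induction xs) auto

lemma list_sum_pull_out:
  assumes "\<And>x. x \<in> set (xs @ y # ys) \<Longrightarrow> f x \<in> carrier R"
  shows "list_sum f (xs @ y # ys) = f y \<oplus> list_sum f (xs @ ys)"
  using assms
proof (induction xs)
  case (Cons x xs)
  then have "f x \<in> carrier R" "f y \<in> carrier R" "list_sum f (xs @ ys) \<in> carrier R" by auto
  then show ?case using Cons by (simp add: add_left_commute)
qed simp

lemma list_sum_single:
  assumes "distinct xs" "y \<in> set xs" "f y \<in> carrier R"
    and "\<And>x. x \<in> set xs \<Longrightarrow> x \<noteq> y \<Longrightarrow> f x = \<zero>"
  shows "list_sum f xs = f y"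
proof -
  have "f x \<in> carrier R" if "x \<in> set xs" for x
    using assms(3,4) that by (cases "x = y") auto
  then have "list_sum f xs = list_sum f (filter ((=) y) xs)"
    using assms(4) by (intro list_sum_filter[symmetric]) auto
  moreover have "filter ((=) y) xs = [y]"
    using assms(1,2) by (induction xs) (auto simp: filter_empty_conv)
  ultimately show ?thesis using assms by simp
qed

end

lemma (in hemiring) ideal_list_sum:
  assumes "ideal I R" "\<And>x. x \<in> set xs \<Longrightarrow> f x \<in> I"
  shows "list_sum f xs \<in> I"
  using assms(2) assms(1)[unfolded ideal_def] by (induction xs) auto

declare (in algebra) smult_closed [simp, intro]


section \<open>Closed walks and exits\<close>

text \<open>A nonempty closed sub-walk of minimal length repeats no vertex.\<close>

lemma (in wf_digraph) cycle_within_closed_walk: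
  assumes "awalk u t u" "t \<noteq> []"
  shows "\<exists>c. cycle c \<and> set c \<subseteq> set t"
  using assms
proof (induction "length t" arbitrary: u t rule: less_induct)
  case less
  show ?case
  proof (cases "distinct (tl (awalk_verts u t))")
    case True
    then show ?thesis using less.prems by (auto simp: cycle_def)
  next
    case False
    obtain e es where t: "t = e # es" using less.prems by (cases t) auto
    with False less.prems have "awalk (head G e) es u" "\<not> distinct (awalk_verts (head G e) es)"
      by (auto simp: awalk_Cons_iff)
    from awalk_not_distinct_decomp[OF this] obtain q r s w
      where "es = q @ r @ s" "awalk w r w" "r \<noteq> []" by blast
    moreover from this obtain c where "cycle c" "set c \<subseteq> set r"
      using less.hyps[of r w] t by auto
    ultimately show ?thesis using t by auto
  qed
qed

lemma (in wf_digraph) closed_walk_has_exit: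
  assumes "\<And>c. cycle c \<Longrightarrow> has_exit G c" "awalk u t u" "t \<noteq> []"
  shows "has_exit G t"
  using cycle_within_closed_walk[OF assms(2,3)] assms(1) by (fastforce simp: has_exit_def)


section \<open>Leavitt families and their monomials\<close>

text \<open>
  The abstract counterpart of the presentation: an algebra generated by elements that satisfy the
  relations. Only these data matter for producing vertices in ideals.
\<close>

locale leavitt_family = algebra A + wf_digraph G
  for A :: "('s::semifield, 'a, 'm) algebra_scheme" (structure)
    and G :: "('v, 'e) pre_digraph" +
  fixes vert :: "'v \<Rightarrow> 'a" and edge ghost :: "'e \<Rightarrow> 'a"
  assumes vert_closed [simp, intro]: "v \<in> verts G \<Longrightarrow> vert v \<in> carrier A"
    and edge_closed [simp, intro]: "e \<in> arcs G \<Longrightarrow> edge e \<in> carrier A"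
    and ghost_closed [simp, intro]: "e \<in> arcs G \<Longrightarrow> ghost e \<in> carrier A"
    and vert_vert: "v \<in> verts G \<Longrightarrow> w \<in> verts G \<Longrightarrow>
      vert v \<otimes> vert w = (if v = w then vert v else \<zero>)"
    and tail_edge: "e \<in> arcs G \<Longrightarrow> vert (tail G e) \<otimes> edge e = edge e"
    and edge_head: "e \<in> arcs G \<Longrightarrow> edge e \<otimes> vert (head G e) = edge e"
    and head_ghost: "e \<in> arcs G \<Longrightarrow> vert (head G e) \<otimes> ghost e = ghost e"
    and ghost_tail: "e \<in> arcs G \<Longrightarrow> ghost e \<otimes> vert (tail G e) = ghost e"
    and ghost_edge: "e \<in> arcs G \<Longrightarrow> f \<in> arcs G \<Longrightarrow>
      ghost e \<otimes> edge f = (if e = f then vert (head G e) else \<zero>)"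
    and vert_regular: "regular_vertex G v \<Longrightarrow> distinct es \<Longrightarrow> set es = out_arcs G v \<Longrightarrow>
      vert v = list_sum (\<lambda>e. edge e \<otimes> ghost e) es"
    and generated [consumes 1, case_names vert edge ghost zero add mul smult]:
      "x \<in> carrier A \<Longrightarrow> (\<And>v. v \<in> verts G \<Longrightarrow> P (vert v)) \<Longrightarrow> (\<And>e. e \<in> arcs G \<Longrightarrow> P (edge e)) \<Longrightarrow>
       (\<And>e. e \<in> arcs G \<Longrightarrow> P (ghost e)) \<Longrightarrow> P \<zero> \<Longrightarrow>
       (\<And>y z. y \<in> carrier A \<Longrightarrow> z \<in> carrier A \<Longrightarrow> P y \<Longrightarrow> P z \<Longrightarrow> P (y \<oplus> z)) \<Longrightarrow>
       (\<And>y z. y \<in> carrier A \<Longrightarrow> z \<in> carrier A \<Longrightarrow> P y \<Longrightarrow> P z \<Longrightarrow> P (y \<otimes> z)) \<Longrightarrow>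
       (\<And>k y. y \<in> carrier A \<Longrightarrow> P y \<Longrightarrow> P (k \<odot> y)) \<Longrightarrow> P x"
begin

lemma vert_edge:
  assumes "v \<in> verts G" "e \<in> arcs G"
  shows "vert v \<otimes> edge e = (if v = tail G e then edge e else \<zero>)"
proof -
  have "vert v \<otimes> edge e = (vert v \<otimes> vert (tail G e)) \<otimes> edge e"
    using assms by (simp add: mul_assoc tail_edge)
  then show ?thesis using assms by (simp add: vert_vert tail_edge zero_mul)
qed

lemma vert_ghost:
  assumes "v \<in> verts G" "e \<in> arcs G"
  shows "vert v \<otimes> ghost e = (if v = head G e then ghost e else \<zero>)"
proof -
  have "vert v \<otimes> ghost e = (vert v \<otimes> vert (head G e)) \<otimes> ghost e"
    using assms by (simp add: mul_assoc head_ghost)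
  then show ?thesis using assms by (simp add: vert_vert head_ghost zero_mul)
qed

lemma ghost_vert:
  assumes "v \<in> verts G" "e \<in> arcs G"
  shows "ghost e \<otimes> vert v = (if v = tail G e then ghost e else \<zero>)"
proof -
  have "ghost e \<otimes> vert v = ghost e \<otimes> (vert (tail G e) \<otimes> vert v)"
    using assms by (simp add: mul_assoc[symmetric] ghost_tail)
  then show ?thesis using assms by (simp add: vert_vert ghost_tail mul_zero)
qed

primrec path :: "'v \<Rightarrow> 'e list \<Rightarrow> 'a" where
  "path u [] = vert u"
| "path u (e # p) = edge e \<otimes> path (head G e) p"

primrec ghost_path :: "'v \<Rightarrow> 'e list \<Rightarrow> 'a" where
  "ghost_path u [] = vert u"
| "ghost_path u (e # p) = ghost_path (head G e) p \<otimes> ghost e"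

lemma path_closed [simp, intro]: "awalk u p x \<Longrightarrow> path u p \<in> carrier A"
  by (induction p arbitrary: u) (auto simp: awalk_simps)

lemma ghost_path_closed [simp, intro]: "awalk u p x \<Longrightarrow> ghost_path u p \<in> carrier A"
  by (induction p arbitrary: u) (auto simp: awalk_simps)

lemma vert_path:
  assumes "awalk u p x" "v \<in> verts G"
  shows "vert v \<otimes> path u p = (if v = u then path u p else \<zero>)"
  using assms
  by (cases p) (auto simp: awalk_simps vert_vert vert_edge zero_mul mul_assoc[symmetric])

lemma path_vert: "awalk u p x \<Longrightarrow> path u p \<otimes> vert x = path u p"
proof (induction p arbitrary: u)
  case (Cons e p)
  then have "awalk (head G e) p x" "e \<in> arcs G" "x \<in> verts G" by (auto simp: awalk_simps)
  then show ?case using Cons.IH by (simp add: mul_assoc path_closed)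
qed (auto simp: awalk_simps vert_vert)

lemma vert_ghost_path: "awalk u p x \<Longrightarrow> vert x \<otimes> ghost_path u p = ghost_path u p"
proof (induction p arbitrary: u)
  case (Cons e p)
  then have "awalk (head G e) p x" "e \<in> arcs G" "x \<in> verts G" by (auto simp: awalk_simps)
  then show ?case using Cons.IH by (simp add: mul_assoc[symmetric] ghost_path_closed)
qed (auto simp: awalk_simps vert_vert)

lemma ghost_path_vert:
  assumes "awalk u p x" "v \<in> verts G"
  shows "ghost_path u p \<otimes> vert v = (if v = u then ghost_path u p else \<zero>)"
  using assms
  by (cases p) (auto simp: awalk_simps vert_vert ghost_vert mul_zero mul_assoc)

lemma path_append:
  assumes "awalk u p x" "awalk x q y"
  shows "path u (p @ q) = path u p \<otimes> path x q"
  using assms(1)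
proof (induction p arbitrary: u)
  case Nil
  then show ?case using assms(2) by (auto simp: awalk_simps vert_path)
next
  case (Cons e p)
  then show ?case using assms(2) by (auto simp: awalk_simps mul_assoc)
qed

text \<open>
  Two paths of which neither extends the other are orthogonal; otherwise cancelling the common
  part leaves the remaining piece of the longer one.
\<close>

lemma ghost_path_mul_path:
  assumes "awalk u p x" "awalk w q y" "length p \<le> length q"
  shows "ghost_path u p \<otimes> path w q =
    (if u = w \<and> take (length p) q = p then path x (drop (length p) q) else \<zero>)"
  using assms
proof (induction p arbitrary: u w q)
  case Nil
  then show ?case by (auto simp: awalk_simps vert_path)
next
  case (Cons e p)
  then obtain f q' where q: "q = f # q'" by (cases q) auto
  have e: "e \<in> arcs G" "u = tail G e" "awalk (head G e) p x"
    and f: "f \<in> arcs G" "w = tail G f" "awalk (head G f) q' y"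
    using Cons.prems q by (auto simp: awalk_simps)
  have "ghost_path u (e # p) \<otimes> path w q =
      ghost_path (head G e) p \<otimes> ((ghost e \<otimes> edge f) \<otimes> path (head G f) q')"
    using e f by (simp add: q mul_assoc path_closed[OF f(3)] ghost_path_closed[OF e(3)])
  also have "\<dots> = (if e = f then ghost_path (head G e) p \<otimes> path (head G e) q' else \<zero>)"
    using e f by (auto simp: ghost_edge vert_path zero_mul mul_zero)
  finally show ?case
    using Cons.IH[OF e(3) f(3)] Cons.prems e f by (auto simp: q)
qed

lemma ghost_path_mul_path_same:
  assumes "awalk u p x" shows "ghost_path u p \<otimes> path u p = vert x"
  using ghost_path_mul_path[OF assms assms] by simp


section \<open>Spanning by monomials\<close>

text \<open>
  The level bounds the length of the ghost part of the monomials. It is the quantity that the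
  search for a vertex in an ideal decreases.
\<close>

inductive_set ghost_span :: "nat \<Rightarrow> 'a set" for n where
  zero: "\<zero> \<in> ghost_span n"
| mono: "awalk u p x \<Longrightarrow> awalk w q x \<Longrightarrow> length q \<le> n \<Longrightarrow>
    k \<odot> (path u p \<otimes> ghost_path w q) \<in> ghost_span n"
| add: "a \<in> ghost_span n \<Longrightarrow> b \<in> ghost_span n \<Longrightarrow> a \<oplus> b \<in> ghost_span n"

lemma ghost_span_closed: "a \<in> ghost_span n \<Longrightarrow> a \<in> carrier A"
  by (induction rule: ghost_span.induct) auto

lemma ghost_span_mono: "a \<in> ghost_span m \<Longrightarrow> m \<le> n \<Longrightarrow> a \<in> ghost_span n"
  by (induction rule: ghost_span.induct) (auto intro: ghost_span.intros)

lemma ghost_span_smult: "a \<in> ghost_span n \<Longrightarrow> k \<odot> a \<in> ghost_span n"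
proof (induction rule: ghost_span.induct)
  case (mono u p x w q l)
  then have "k \<odot> l \<odot> (path u p \<otimes> ghost_path w q) = (k * l) \<odot> (path u p \<otimes> ghost_path w q)"
    by (subst smult_smult) auto
  then show ?case using mono by (auto intro: ghost_span.mono)
qed (auto simp: smult_zero smult_add ghost_span_closed intro: ghost_span.intros)

lemma ghost_span_mul_vert:
  "a \<in> ghost_span n \<Longrightarrow> v \<in> verts G \<Longrightarrow> a \<otimes> vert v \<in> ghost_span n"
proof (induction rule: ghost_span.induct)
  case (mono u p x w q l)
  then have "l \<odot> (path u p \<otimes> ghost_path w q) \<otimes> vert v =
      (if v = w then l \<odot> (path u p \<otimes> ghost_path w q) else \<zero>)"
    using ghost_path_vert[OF mono(2)]
    by (auto simp: smult_mul_left mul_assoc path_closed ghost_path_closed mul_zero smult_zero)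
  then show ?case using mono by (auto intro: ghost_span.intros)
qed (auto simp: zero_mul distrib_right ghost_span_closed intro: ghost_span.intros)

lemma ghost_span_mul_edge:
  "a \<in> ghost_span (Suc n) \<Longrightarrow> e \<in> arcs G \<Longrightarrow> a \<otimes> edge e \<in> ghost_span n"
proof (induction rule: ghost_span.induct)
  case (mono u p x w q l)
  have eq: "l \<odot> (path u p \<otimes> ghost_path w q) \<otimes> edge e = l \<odot> (path u p \<otimes> (ghost_path w q \<otimes> edge e))"
    using mono by (simp add: smult_mul_left mul_assoc path_closed ghost_path_closed)
  show ?case
  proof (cases q)
    case Nil
    then have "w = x" "w \<in> verts G" using mono by (auto simp: awalk_simps)
    show ?thesis
    proof (cases "x = tail G e")
      case True
      have "path u p \<otimes> edge e = path u (p @ [e]) \<otimes> ghost_path (head G e) []"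
        using mono(1,4) True
        by (subst path_append[OF mono(1)])
          (auto simp: awalk_simps mul_assoc edge_head vert_vert path_closed)
      moreover have "awalk u (p @ [e]) (head G e)"
        using mono(1,4) True by (auto intro: awalk_appendI simp: awalk_simps)
      ultimately have "l \<odot> (path u p \<otimes> edge e) \<in> ghost_span n"
        using ghost_span.mono[of u "p @ [e]" "head G e" "head G e" "[]" n l] mono(4)
        by (simp add: awalk_simps del: awalk_append_iff ghost_path.simps)
      then show ?thesis
        using True \<open>w = x\<close> mono(4) Nil unfolding eq by (simp add: tail_edge)
    next
      case False
      then show ?thesis using \<open>w = x\<close> \<open>w \<in> verts G\<close> mono(1,4) Nil unfolding eq
        by (simp add: vert_edge mul_zero smult_zero path_closed ghost_span.zero)
    qed
  next
    case (Cons f q')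
    then have f: "f \<in> arcs G" "w = tail G f" "awalk (head G f) q' x" "length q' \<le> n"
      using mono by (auto simp: awalk_simps)
    have "ghost_path w q \<otimes> edge e = ghost_path (head G f) q' \<otimes> (ghost f \<otimes> edge e)"
      using f mono(4) Cons by (simp add: mul_assoc ghost_path_closed)
    also have "\<dots> = (if f = e then ghost_path (head G f) q' else \<zero>)"
      using f mono(4) by (auto simp: ghost_edge ghost_path_vert mul_zero ghost_path_closed)
    finally show ?thesis using f mono(1) unfolding eq
      by (auto simp: mul_zero smult_zero path_closed intro: ghost_span.intros)
  qed
qed (auto simp: zero_mul distrib_right ghost_span_closed intro: ghost_span.intros)

lemma ghost_span_mul_ghost:
  "a \<in> ghost_span n \<Longrightarrow> e \<in> arcs G \<Longrightarrow> a \<otimes> ghost e \<in> ghost_span (Suc n)"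
proof (induction rule: ghost_span.induct)
  case (mono u p x w q l)
  have w: "w \<in> verts G" using mono(2) by auto
  have eq: "l \<odot> (path u p \<otimes> ghost_path w q) \<otimes> ghost e = l \<odot> (path u p \<otimes> (ghost_path w q \<otimes> ghost e))"
    using mono by (simp add: smult_mul_left mul_assoc path_closed ghost_path_closed)
  show ?case
  proof (cases "w = head G e")
    case True
    have "ghost_path w q \<otimes> ghost e = ghost_path (tail G e) (e # q)" using True by simp
    moreover have "awalk (tail G e) (e # q) x" using True mono by (simp add: awalk_simps)
    moreover have "length (e # q) \<le> Suc n" using mono(3) by simp
    ultimately show ?thesis using mono(1) unfolding eq by (metis ghost_span.mono)
  next
    case False
    have "ghost_path w q \<otimes> ghost e = ghost_path w q \<otimes> (vert w \<otimes> ghost e)"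
      using mono w by (simp add: mul_assoc[symmetric] ghost_path_vert ghost_path_closed)
    also have "\<dots> = \<zero>"
      using mono w False by (simp add: vert_ghost mul_zero ghost_path_closed)
    finally show ?thesis using mono unfolding eq
      by (auto simp: mul_zero smult_zero path_closed intro: ghost_span.intros)
  qed
qed (auto simp: zero_mul distrib_right ghost_span_closed intro: ghost_span.intros)

text \<open>
  Right multiplication by a generator preserves the span of all monomials, hence so does right
  multiplication by anything; this is why the monomials span although there need not be an identity
  to multiply into.
\<close>

lemma in_ghost_span:
  assumes "a \<in> carrier A" shows "\<exists>n. a \<in> ghost_span n"
proof -
  define S where "S = (\<Union>n. ghost_span n)"
  have S_I: "b \<in> ghost_span n \<Longrightarrow> b \<in> S" for b n by (auto simp: S_def)
  have S_E: "b \<in> S \<Longrightarrow> \<exists>n. b \<in> ghost_span n" for b by (auto simp: S_def)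
  have S_add: "b \<oplus> c \<in> S" if "b \<in> S" "c \<in> S" for b c
  proof -
    from that obtain m n where "b \<in> ghost_span m" "c \<in> ghost_span n" by (blast dest: S_E)
    then have "b \<in> ghost_span (max m n)" "c \<in> ghost_span (max m n)"
      by (auto intro: ghost_span_mono)
    then show ?thesis by (blast intro: ghost_span.add S_I)
  qed
  have S_smult: "k \<odot> b \<in> S" if "b \<in> S" for k b using that by (blast intro: ghost_span_smult S_I dest: S_E)
  have S_closed: "b \<in> carrier A" if "b \<in> S" for b using that by (auto dest: S_E ghost_span_closed)
  have gen: "vert v \<in> S" if "v \<in> verts G" for v
  proof -
    have "1 \<odot> (path v [] \<otimes> ghost_path v []) \<in> ghost_span 0"
      using that by (intro ghost_span.mono) (auto simp: awalk_simps)
    then have "vert v \<in> S" using that by (auto dest!: S_I simp: vert_vert one_smult)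
    then show ?thesis .
  qed
  have gen_e: "edge e \<in> S" if "e \<in> arcs G" for e
  proof -
    have "1 \<odot> (path (tail G e) [e] \<otimes> ghost_path (head G e) []) \<in> ghost_span 0"
      using that by (intro ghost_span.mono) (auto simp: awalk_simps)
    then have "edge e \<in> S" using that by (auto dest!: S_I simp: edge_head one_smult)
    then show ?thesis .
  qed
  have gen_g: "ghost e \<in> S" if "e \<in> arcs G" for e
  proof -
    have "1 \<odot> (path (head G e) [] \<otimes> ghost_path (tail G e) [e]) \<in> ghost_span 1"
      using that by (intro ghost_span.mono) (auto simp: awalk_simps)
    then have "ghost e \<in> S" using that by (auto dest!: S_I simp: head_ghost one_smult)
    then show ?thesis .
  qed
  have "a \<in> S \<and> (\<forall>b\<in>S. b \<otimes> a \<in> S)"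
    using assms
  proof (induction rule: generated)
    case (vert v)
    then show ?case using gen by (blast intro: ghost_span_mul_vert S_I dest: S_E)
  next
    case (edge e)
    then show ?case using gen_e by (blast intro: ghost_span_mul_edge ghost_span_mono le_SucI S_I dest: S_E)
  next
    case (ghost e)
    then show ?case using gen_g by (blast intro: ghost_span_mul_ghost S_I dest: S_E)
  next
    case zero
    then show ?case using ghost_span.zero by (auto simp: mul_zero S_closed intro: S_I)
  next
    case (add y z)
    then show ?case by (auto simp: distrib_left S_closed intro!: S_add)
  next
    case (mul y z)
    then show ?case by (metis S_closed mul_assoc)
  next
    case (smult k y)
    then show ?case by (metis S_closed S_smult smult_mul_right)
  qed
  then show ?thesis by (blast dest: S_E)
qed

text \<open>
  The algebra need not have an identity, but the sum of finitely many vertices, if there are enough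
  of them, is a right identity for a given element.
\<close>

lemma finite_local_unit:
  assumes "a \<in> ghost_span n"
  shows "\<exists>W. finite W \<and> W \<subseteq> verts G \<and>
    (\<forall>vs. distinct vs \<and> W \<subseteq> set vs \<and> set vs \<subseteq> verts G \<longrightarrow> a \<otimes> list_sum vert vs = a)"
  using assms
proof (induction rule: ghost_span.induct)
  case zero
  then show ?case by (intro exI[of _ "{}"]) (auto simp: zero_mul subset_iff)
next
  case (mono u p x w q k)
  show ?case
  proof (intro exI[of _ "{w}"] conjI allI impI; (elim conjE)?)
    show "{w} \<subseteq> verts G" using mono by auto
    fix vs assume vs: "distinct vs" "{w} \<subseteq> set vs" "set vs \<subseteq> verts G"
    have "ghost_path w q \<otimes> list_sum vert vs = list_sum (\<lambda>v. ghost_path w q \<otimes> vert v) vs"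
      using mono vs by (intro mul_list_sum) auto
    also have "\<dots> = ghost_path w q \<otimes> vert w"
      using mono vs by (intro list_sum_single) (auto simp: ghost_path_vert)
    also have "\<dots> = ghost_path w q" using mono vs by (auto simp: ghost_path_vert)
    finally have "path u p \<otimes> (ghost_path w q \<otimes> list_sum vert vs) = path u p \<otimes> ghost_path w q"
      by simp
    moreover have "list_sum vert vs \<in> carrier A" using vs by auto
    ultimately show "k \<odot> (path u p \<otimes> ghost_path w q) \<otimes> list_sum vert vs =
        k \<odot> (path u p \<otimes> ghost_path w q)"
      using mono by (simp add: smult_mul_left mul_assoc path_closed ghost_path_closed)
  qed auto
next
  case (add a b)
  then obtain V W where V: "finite V" "V \<subseteq> verts G"
      "\<And>vs. distinct vs \<Longrightarrow> V \<subseteq> set vs \<Longrightarrow> set vs \<subseteq> verts G \<Longrightarrow> a \<otimes> list_sum vert vs = a"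
    and W: "finite W" "W \<subseteq> verts G"
      "\<And>vs. distinct vs \<Longrightarrow> W \<subseteq> set vs \<Longrightarrow> set vs \<subseteq> verts G \<Longrightarrow> b \<otimes> list_sum vert vs = b"
    by metis
  show ?case
  proof (intro exI[of _ "V \<union> W"] conjI allI impI; (elim conjE)?)
    fix vs assume vs: "distinct vs" "V \<union> W \<subseteq> set vs" "set vs \<subseteq> verts G"
    then have "list_sum vert vs \<in> carrier A" by auto
    then show "(a \<oplus> b) \<otimes> list_sum vert vs = a \<oplus> b"
      using vs V(3)[of vs] W(3)[of vs] add(1,2) by (auto simp: distrib_right ghost_span_closed)
  qed (use V W in auto)
qed

lemma nonzero_at_vertex:
  assumes "a \<in> carrier A" "a \<noteq> \<zero>"
  obtains v where "v \<in> verts G" "a \<otimes> vert v \<noteq> \<zero>"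
proof -
  obtain n where "a \<in> ghost_span n" using in_ghost_span[OF assms(1)] by blast
  then obtain W where W: "finite W" "W \<subseteq> verts G"
      "\<And>vs. distinct vs \<Longrightarrow> W \<subseteq> set vs \<Longrightarrow> set vs \<subseteq> verts G \<Longrightarrow> a \<otimes> list_sum vert vs = a"
    using finite_local_unit[of a n] by auto
  obtain vs where vs: "set vs = W" "distinct vs" using finite_distinct_list[OF W(1)] by blast
  have "a = a \<otimes> list_sum vert vs" using W vs by simp
  also have "\<dots> = list_sum (\<lambda>v. a \<otimes> vert v) vs" using W vs assms by (intro mul_list_sum) auto
  finally have "\<exists>v\<in>set vs. a \<otimes> vert v \<noteq> \<zero>" using list_sum_zero assms(2) by metis
  then show ?thesis using that W vs by blast
qed

end


section \<open>Nonzero ideals contain vertices\<close>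

context leavitt_family
begin

definition path_term :: "'s \<times> 'v \<times> 'e list \<Rightarrow> 'a" where
  "path_term = (\<lambda>(k, u, p). k \<odot> path u p)"

lemma path_term_simp [simp]: "path_term (k, u, p) = k \<odot> path u p"
  by (simp add: path_term_def)

lemma path_term_closed:
  assumes "s \<in> set R" "\<And>k u p. (k, u, p) \<in> set R \<Longrightarrow> awalk u p x"
  shows "path_term s \<in> carrier A"
proof -
  obtain k u p where s: "s = (k, u, p)" by (metis prod_cases3)
  then have "awalk u p x" using assms by simp
  then show ?thesis by (simp add: s path_closed)
qed

text \<open>Multiples of vertices suffice, because nonzero scalars are invertible.\<close>

lemma vert_of_scaled_vert:
  assumes "ideal I A" "v \<in> verts G" "k \<noteq> 0" "k \<odot> vert v \<in> I"
  shows "vert v \<in> I"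
proof -
  obtain l where l: "k * l = 1" using nonzero_invertible assms(3) by blast
  have "(l \<odot> vert v) \<otimes> (k \<odot> vert v) = (k * l) \<odot> vert v"
    using assms(2) by (simp add: smult_mul_left smult_mul_right vert_vert smult_smult[symmetric] mult.commute)
  then have "(l \<odot> vert v) \<otimes> (k \<odot> vert v) = vert v" using assms(2) by (simp add: l one_smult)
  then show ?thesis using assms unfolding ideal_def by (metis smult_closed vert_closed)
qed

text \<open>
  Conjugating by a path \<open>\<mu>\<close> that follows one of the closed paths up to an exit, and then leaves,
  kills that closed path and turns every other one into zero or a closed path of the same length
  at the end of \<open>\<mu>\<close>, while the vertex survives. Thus the number of terms drops.
\<close>

lemma vert_of_vert_plus_closed_paths:
  assumes exits: "\<forall>x t. awalk x t x \<longrightarrow> t \<noteq> [] \<longrightarrow> has_exit G t"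
    and I: "ideal I A"
    and "k \<noteq> 0" "x \<in> verts G" "\<forall>(l, t)\<in>set Q. awalk x t x \<and> t \<noteq> []"
    and "k \<odot> vert x \<oplus> list_sum (\<lambda>(l, t). l \<odot> path x t) Q \<in> I"
  shows "\<exists>v\<in>verts G. vert v \<in> I"
  using assms(3-)
proof (induction "length Q" arbitrary: x Q rule: less_induct)
  case less
  show ?case
  proof (cases Q)
    case Nil
    then have "k \<odot> vert x \<in> I" using less.prems by simp
    then show ?thesis using vert_of_scaled_vert[OF I] less.prems by blast
  next
    case (Cons c Q')
    obtain k1 t1 where c: "c = (k1, t1)" by (cases c)
    have t1: "awalk x t1 x" "t1 \<noteq> []" using less.prems(3) Cons c by auto
    obtain e f where ef: "e \<in> set t1" "f \<in> arcs G" "tail G f = tail G e" "f \<noteq> e"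
      using exits t1 by (meson has_exit_def)
    obtain p1 p2 where p: "t1 = p1 @ e # p2" using ef(1) by (meson split_list)
    define \<mu> y where "\<mu> = p1 @ [f]" and "y = head G f"
    have \<mu>: "awalk x \<mu> y" and "\<mu> \<noteq> []" and y: "y \<in> verts G"
      using t1(1) ef by (auto simp: p \<mu>_def y_def awalk_simps)
    define P where "P t \<longleftrightarrow> take (length \<mu>) (t @ \<mu>) = \<mu>" for t
    define g where "g t = drop (length \<mu>) (t @ \<mu>)" for t
    have conj: "ghost_path x \<mu> \<otimes> (path x t \<otimes> path x \<mu>) = (if P t then path y (g t) else \<zero>)"
      if "awalk x t x" for t
      using ghost_path_mul_path[OF \<mu> awalk_appendI[OF that \<mu>]] path_append[OF that \<mu>]
      by (simp add: P_def g_def)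
    have closed_walk: "awalk y (g t) y" if "awalk x t x" "P t" for t
    proof -
      have "t @ \<mu> = \<mu> @ g t" using that(2) unfolding P_def g_def by (metis append_take_drop_id)
      then have "awalk x (\<mu> @ g t) y" using awalk_appendI[OF that(1) \<mu>] by simp
      then show ?thesis using \<mu> by simp
    qed
    have Q: "awalk x t x" "t \<noteq> []" "path x t \<in> carrier A" if "(l, t) \<in> set Q" for l t
      using less.prems(3) that by auto
    define Q2 where "Q2 = map (\<lambda>(l, t). (l, g t)) (filter (\<lambda>(l, t). P t) Q)"
    have S: "list_sum (\<lambda>(l, t). l \<odot> path x t) Q \<in> carrier A"
      using Q(3) by (intro list_sum_closed) auto
    have "ghost_path x \<mu> \<otimes> (list_sum (\<lambda>(l, t). l \<odot> path x t) Q \<otimes> path x \<mu>) =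
        ghost_path x \<mu> \<otimes> list_sum (\<lambda>b. (case b of (l, t) \<Rightarrow> l \<odot> path x t) \<otimes> path x \<mu>) Q"
      using Q(3) \<mu> by (subst list_sum_mul) auto
    also have "\<dots> = list_sum (\<lambda>b. ghost_path x \<mu> \<otimes> ((case b of (l, t) \<Rightarrow> l \<odot> path x t) \<otimes> path x \<mu>)) Q"
      using Q(3) \<mu> by (intro mul_list_sum) auto
    also have "\<dots> = list_sum (\<lambda>(l, t). l \<odot> (if P t then path y (g t) else \<zero>)) Q"
    proof (intro list_sum_cong)
      fix b assume "b \<in> set Q"
      moreover obtain l t where b: "b = (l, t)" by (cases b)
      ultimately have t: "awalk x t x" using Q by auto
      have "path x t \<in> carrier A" "path x \<mu> \<in> carrier A" "ghost_path x \<mu> \<in> carrier A"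
        using t \<mu> by auto
      then show "ghost_path x \<mu> \<otimes> ((case b of (l, t) \<Rightarrow> l \<odot> path x t) \<otimes> path x \<mu>) =
          (case b of (l, t) \<Rightarrow> l \<odot> (if P t then path y (g t) else \<zero>))"
        by (simp add: b smult_mul_left smult_mul_right conj[OF t])
    qed
    also have "\<dots> = list_sum (\<lambda>(l, t). l \<odot> (if P t then path y (g t) else \<zero>))
        (filter (\<lambda>(l, t). P t) Q)"
      using Q(1) by (intro list_sum_filter[symmetric])
        (auto simp: smult_zero intro!: smult_closed path_closed[OF closed_walk])
    also have "\<dots> = list_sum (\<lambda>(l, t). l \<odot> path y t) Q2"
      unfolding Q2_def list_sum_map by (intro list_sum_cong) auto
    finally have sum: "ghost_path x \<mu> \<otimes> (list_sum (\<lambda>(l, t). l \<odot> path x t) Q \<otimes> path x \<mu>) =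
        list_sum (\<lambda>(l, t). l \<odot> path y t) Q2" .
    have "ghost_path x \<mu> \<otimes> ((k \<odot> vert x \<oplus> list_sum (\<lambda>(l, t). l \<odot> path x t) Q) \<otimes> path x \<mu>) \<in> I"
      using less.prems(4) I path_closed[OF \<mu>] ghost_path_closed[OF \<mu>] unfolding ideal_def by blast
    moreover have "ghost_path x \<mu> \<otimes> ((k \<odot> vert x \<oplus> list_sum (\<lambda>(l, t). l \<odot> path x t) Q) \<otimes> path x \<mu>) =
        k \<odot> vert y \<oplus> list_sum (\<lambda>(l, t). l \<odot> path y t) Q2"
      unfolding sum[symmetric] using S less.prems(2) path_closed[OF \<mu>] ghost_path_closed[OF \<mu>]
      by (simp add: distrib_left distrib_right smult_mul_left smult_mul_right vert_path[OF \<mu>]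
          ghost_path_mul_path_same[OF \<mu>])
    ultimately have in_I: "k \<odot> vert y \<oplus> list_sum (\<lambda>(l, t). l \<odot> path y t) Q2 \<in> I" by simp
    have "\<not> P t1" using ef(4) by (auto simp: p \<mu>_def P_def)
    then have "length Q2 < length Q"
      by (auto simp: Q2_def Cons c intro: le_imp_less_Suc)
    moreover have "\<forall>(l, t)\<in>set Q2. awalk y t y \<and> t \<noteq> []"
    proof -
      have "g t \<noteq> []" if "t \<noteq> []" for t using that by (simp add: g_def del: drop_append)
      then show ?thesis using Q(1,2) closed_walk by (auto simp: Q2_def)
    qed
    ultimately show ?thesis
      using less.hyps[OF _ less.prems(1) y _ in_I] by blast
  qed
qed

text \<open>
  Multiplying by the ghost of a shortest path occurring in the combination turns this path into a
  vertex, and the others into zero or closed paths at that vertex.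
\<close>

lemma vert_of_path_combination:
  assumes exits: "\<forall>x t. awalk x t x \<longrightarrow> t \<noteq> [] \<longrightarrow> has_exit G t"
    and I: "ideal I A"
    and R: "R \<noteq> []" "distinct (map snd R)" "\<And>k u p. (k, u, p) \<in> set R \<Longrightarrow> k \<noteq> 0 \<and> awalk u p x"
    and in_I: "list_sum path_term R \<in> I"
  shows "\<exists>v\<in>verts G. vert v \<in> I"
proof -
  have "\<exists>r. r \<in> set R \<and> (\<forall>s. s \<in> set R \<longrightarrow> length (snd (snd r)) \<le> length (snd (snd s)))"
    using R(1) by (intro ex_has_least_nat[of _ "hd R"]) auto
  then obtain k u p where r: "(k, u, p) \<in> set R"
    and least: "\<And>l w q. (l, w, q) \<in> set R \<Longrightarrow> length p \<le> length q" by fastforce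
  have p: "awalk u p x" "k \<noteq> 0" using R(3) r by auto
  then have x: "x \<in> verts G" by auto
  obtain R1 R2 where split: "R = R1 @ (k, u, p) # R2" using r by (meson split_list)
  have other: "(w, q) \<noteq> (u, p)" if "(l, w, q) \<in> set (R1 @ R2)" for l w q
    using R(2) that by (force simp: split)
  have R_awalk: "awalk w q x" if "(l, w, q) \<in> set R" for l w q using R(3) that by blast
  have closed: "path_term s \<in> carrier A" if "s \<in> set R" for s
    using path_term_closed[OF that R_awalk] .
  let ?P = "\<lambda>(l, w, q). w = u \<and> take (length p) q = p"
  define Q where "Q = map (\<lambda>(l, w, q). (l, drop (length p) q)) (filter ?P (R1 @ R2))"
  have mul: "ghost_path u p \<otimes> path_term s =
      (case s of (l, w, q) \<Rightarrow> if ?P s then l \<odot> path x (drop (length p) q) else \<zero>)"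
    if "s \<in> set R" for s
  proof -
    obtain l w q where s: "s = (l, w, q)" by (metis prod_cases3)
    have "awalk w q x" using R_awalk that s by auto
    then show ?thesis
      using least that ghost_path_closed[OF p(1)] ghost_path_mul_path[OF p(1) \<open>awalk w q x\<close>]
      by (auto simp: s smult_mul_right smult_zero)
  qed
  have Q: "awalk x t x \<and> t \<noteq> []" if lt: "(l, t) \<in> set Q" for l t
  proof -
    obtain q where q: "(l, u, q) \<in> set (R1 @ R2)" "take (length p) q = p" "t = drop (length p) q"
      using lt by (auto simp: Q_def)
    then have "q = p @ t" by (metis append_take_drop_id)
    moreover have "awalk u q x" using R_awalk q(1) by (auto simp: split)
    ultimately show ?thesis using other[OF q(1)] p(1) by auto
  qed
  have "ghost_path u p \<otimes> list_sum path_term R = list_sum (\<lambda>s. ghost_path u p \<otimes> path_term s) R"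
    using closed ghost_path_closed[OF p(1)] by (intro mul_list_sum)
  also have "\<dots> = ghost_path u p \<otimes> path_term (k, u, p) \<oplus>
      list_sum (\<lambda>s. ghost_path u p \<otimes> path_term s) (R1 @ R2)"
    using closed ghost_path_closed[OF p(1)] unfolding split by (intro list_sum_pull_out) auto
  also have "ghost_path u p \<otimes> path_term (k, u, p) = k \<odot> vert x"
    using p(1) by (simp add: smult_mul_right ghost_path_mul_path_same path_closed ghost_path_closed)
  also have "list_sum (\<lambda>s. ghost_path u p \<otimes> path_term s) (R1 @ R2) =
      list_sum (\<lambda>s. ghost_path u p \<otimes> path_term s) (filter ?P (R1 @ R2))"
  proof (intro list_sum_filter[symmetric])
    fix s assume "s \<in> set (R1 @ R2)"
    then have s: "s \<in> set R" by (auto simp: split)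
    show "ghost_path u p \<otimes> path_term s \<in> carrier A"
      using closed[OF s] ghost_path_closed[OF p(1)] by blast
    show "ghost_path u p \<otimes> path_term s = \<zero>" if "\<not> ?P s"
      using mul[OF s] that by (auto split: prod.splits)
  qed
  also have "\<dots> = list_sum (\<lambda>(l, t). l \<odot> path x t) Q"
    unfolding Q_def list_sum_map
  proof (intro list_sum_cong)
    fix s assume "s \<in> set (filter ?P (R1 @ R2))"
    then have "s \<in> set R" "?P s" by (auto simp: split)
    then show "ghost_path u p \<otimes> path_term s =
        (case case s of (l, w, q) \<Rightarrow> (l, drop (length p) q) of (l, t) \<Rightarrow> l \<odot> path x t)"
      using mul by (auto split: prod.splits)
  qed
  finally have "k \<odot> vert x \<oplus> list_sum (\<lambda>(l, t). l \<odot> path x t) Q \<in> I"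
    using in_I I ghost_path_closed[OF p(1)] unfolding ideal_def by metis
  then show ?thesis using vert_of_vert_plus_closed_paths[OF exits I p(2) x, where Q = Q] Q by blast
qed

text \<open>In this form a shortest path occurs only once, and its coefficient is invertible.\<close>

lemma collect_path_terms:
  assumes "\<And>k u p. (k, u, p) \<in> set R \<Longrightarrow> awalk u p x"
  shows "\<exists>R'. distinct (map snd R') \<and> (\<forall>(k, u, p)\<in>set R'. k \<noteq> 0 \<and> awalk u p x)
    \<and> list_sum path_term R' = list_sum path_term R"
  using assms
proof (induction R)
  case Nil
  then show ?case by (intro exI[of _ "[]"]) auto
next
  case (Cons r R)
  obtain k u p where r: "r = (k, u, p)" by (metis prod_cases3)
  have p: "awalk u p x" using Cons.prems r by auto
  obtain R' where R': "distinct (map snd R')" "\<And>k u p. (k, u, p) \<in> set R' \<Longrightarrow> k \<noteq> 0 \<and> awalk u p x"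
      "list_sum path_term R' = list_sum path_term R"
    using Cons.IH Cons.prems by fastforce
  have closed: "path_term s \<in> carrier A" if "s \<in> set R'" for s
    using path_term_closed[OF that, of x] R'(2) by blast
  then have sum_closed: "list_sum path_term R' \<in> carrier A" by auto
  consider "k = 0" | "k \<noteq> 0" "(u, p) \<notin> snd ` set R'" | l where "k \<noteq> 0" "(l, u, p) \<in> set R'"
    by force
  then show ?case
  proof cases
    case 1
    then show ?thesis using R' p sum_closed by (intro exI[of _ R']) (auto simp: r zero_smult)
  next
    case 2
    then show ?thesis using R' p by (intro exI[of _ "r # R'"]) (auto simp: r)
  next
    case (3 l)
    obtain R1 R2 where split: "R' = R1 @ (l, u, p) # R2" using 3(2) by (meson split_list)
    have rest: "list_sum path_term (R1 @ R2) \<in> carrier A" using closed by (auto simp: split)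
    have "list_sum path_term R' = l \<odot> path u p \<oplus> list_sum path_term (R1 @ R2)"
      using list_sum_pull_out[of R1 "(l, u, p)" R2 path_term] closed unfolding split by simp
    then have sum: "list_sum path_term (r # R) = (k + l) \<odot> path u p \<oplus> list_sum path_term (R1 @ R2)"
      using p rest by (simp add: r R'(3)[symmetric] add_smult add_assoc path_closed)
    have "(u, p) \<notin> snd ` set (R1 @ R2)" "distinct (map snd (R1 @ R2))"
      using R'(1) by (auto simp: split)
    then show ?thesis
      using R'(2) p sum rest
      by (cases "k + l = 0"; intro exI[of _ "if k + l = 0 then R1 @ R2 else (k + l, u, p) # R1 @ R2"])
        (auto simp: split zero_smult)
  qed
qed

text \<open>
  The extra path \<open>q\<close> is there because a nonzero combination may only be known to lie in the ideal
  after multiplication by \<open>q\<close>. Distinct paths stay distinct under appending \<open>q\<close>, so the nonzero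
  coefficients survive, although the product is not known to be nonzero beforehand.
\<close>

lemma vert_of_extended_path_combination:
  assumes exits: "\<forall>x t. awalk x t x \<longrightarrow> t \<noteq> [] \<longrightarrow> has_exit G t"
    and I: "ideal I A"
    and R: "\<forall>(k, u, p)\<in>set R. awalk u p x" "list_sum path_term R \<noteq> \<zero>"
    and q: "awalk x q y" and in_I: "list_sum path_term R \<otimes> path x q \<in> I"
  shows "\<exists>v\<in>verts G. vert v \<in> I"
proof -
  obtain R' where R': "distinct (map snd R')" "\<And>k u p. (k, u, p) \<in> set R' \<Longrightarrow> k \<noteq> 0 \<and> awalk u p x"
      "list_sum path_term R' = list_sum path_term R"
    using collect_path_terms[of R x] R(1) by fastforce
  let ?f = "\<lambda>(k, u, p). (k, u, p @ q)"
  have closed: "path_term s \<in> carrier A" if "s \<in> set R'" for s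
    using path_term_closed[OF that, of x] R'(2) by blast
  have "list_sum path_term R' \<otimes> path x q = list_sum (\<lambda>s. path_term s \<otimes> path x q) R'"
    using closed path_closed[OF q] by (intro list_sum_mul)
  also have "\<dots> = list_sum (\<lambda>s. path_term (?f s)) R'"
  proof (intro list_sum_cong)
    fix s assume "s \<in> set R'"
    moreover obtain k u p where s: "s = (k, u, p)" by (metis prod_cases3)
    ultimately have p: "awalk u p x" using R'(2) by auto
    then show "path_term s \<otimes> path x q = path_term (?f s)"
      using path_closed[OF q] path_closed[OF p] by (simp add: s path_append[OF p q] smult_mul_left)
  qed
  finally have in_I': "list_sum path_term (map ?f R') \<in> I"
    using in_I by (simp add: R'(3) list_sum_map)
  have "map snd (map ?f R') = map (\<lambda>(u, p). (u, p @ q)) (map snd R')" by auto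
  moreover have "inj (\<lambda>(u, p). (u, p @ q))" by (auto intro: injI)
  ultimately have "distinct (map snd (map ?f R'))"
    using R'(1) by (metis distinct_map inj_on_subset subset_UNIV)
  moreover have "map ?f R' \<noteq> []" using R(2) R'(3) by auto
  moreover have "k \<noteq> 0 \<and> awalk u p y" if kup: "(k, u, p) \<in> set (map ?f R')" for k u p
  proof -
    obtain p' where "(k, u, p') \<in> set R'" "p = p' @ q" using kup by auto
    then show ?thesis using R'(2) awalk_appendI[OF _ q] by blast
  qed
  ultimately show ?thesis using vert_of_path_combination[OF exits I _ _ _ in_I'] by blast
qed

lemma ghost_span_at_vert:
  assumes "a \<in> ghost_span n" "v \<in> verts G"
  shows "\<exists>R B. a \<otimes> vert v = list_sum path_term R \<oplus> list_sum (\<lambda>(b, e). b \<otimes> ghost e) B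
    \<and> (\<forall>(k, u, p)\<in>set R. awalk u p v) \<and> (\<forall>(b, e)\<in>set B. b \<in> carrier A \<and> e \<in> out_arcs G v)
    \<and> (n = 0 \<longrightarrow> B = [])"
  using assms(1)
proof (induction rule: ghost_span.induct)
  case zero
  then show ?case using assms(2) by (intro exI[of _ "[]"]) (auto simp: zero_mul)
next
  case (mono u p x w q k)
  have closed: "path u p \<in> carrier A" "ghost_path w q \<in> carrier A"
    using mono by auto
  have eq: "k \<odot> (path u p \<otimes> ghost_path w q) \<otimes> vert v =
      k \<odot> (path u p \<otimes> (if v = w then ghost_path w q else \<zero>))"
    using closed assms(2)
    by (simp add: smult_mul_left mul_assoc ghost_path_vert[OF mono(2) assms(2)])
  show ?case
  proof (cases "v = w")
    case False
    then show ?thesis unfolding eq using closed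
      by (intro exI[of _ "[]"]) (auto simp: mul_zero smult_zero)
  next
    case vw: True
    show ?thesis
    proof (cases q)
      case Nil
      then have "w = x" using mono(2) by (auto simp: awalk_simps)
      then show ?thesis unfolding eq using vw closed mono(1) Nil
        by (intro exI[of _ "[(k, u, p)]"] exI[of _ "[]"]) (auto simp: path_vert)
    next
      case (Cons e q')
      then have e: "e \<in> arcs G" "w = tail G e" "awalk (head G e) q' x" "n \<noteq> 0"
        using mono by (auto simp: awalk_simps)
      have "k \<odot> (path u p \<otimes> ghost_path w q) = (k \<odot> (path u p \<otimes> ghost_path (head G e) q')) \<otimes> ghost e"
        using closed(1) e ghost_path_closed[OF e(3)]
        by (simp add: Cons smult_mul_left mul_assoc)
      then show ?thesis unfolding eq using vw closed(1) e ghost_path_closed[OF e(3)]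
        by (intro exI[of _ "[]"] exI[of _ "[(k \<odot> (path u p \<otimes> ghost_path (head G e) q'), e)]"]) auto
    qed
  qed
next
  case (add a b)
  obtain R1 B1 where 1: "a \<otimes> vert v = list_sum path_term R1 \<oplus> list_sum (\<lambda>(b, e). b \<otimes> ghost e) B1"
    "\<forall>(k, u, p)\<in>set R1. awalk u p v" "\<forall>(b, e)\<in>set B1. b \<in> carrier A \<and> e \<in> out_arcs G v"
    "n = 0 \<longrightarrow> B1 = []" using add.IH(1) by blast
  obtain R2 B2 where 2: "b \<otimes> vert v = list_sum path_term R2 \<oplus> list_sum (\<lambda>(b, e). b \<otimes> ghost e) B2"
    "\<forall>(k, u, p)\<in>set R2. awalk u p v" "\<forall>(b, e)\<in>set B2. b \<in> carrier A \<and> e \<in> out_arcs G v"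
    "n = 0 \<longrightarrow> B2 = []" using add.IH(2) by blast
  have R: "path_term s \<in> carrier A" if "s \<in> set (R1 @ R2)" for s
    using path_term_closed[OF that, of v] 1(2) 2(2) by (simp add: split_beta) fastforce
  have B: "(case s of (b, e) \<Rightarrow> b \<otimes> ghost e) \<in> carrier A" if "s \<in> set (B1 @ B2)" for s
    using 1(3) 2(3) that by (cases s) auto
  have closed: "list_sum path_term R1 \<in> carrier A" "list_sum path_term R2 \<in> carrier A"
    "list_sum (\<lambda>(b, e). b \<otimes> ghost e) B1 \<in> carrier A" "list_sum (\<lambda>(b, e). b \<otimes> ghost e) B2 \<in> carrier A"
    using R B by auto
  have append: "list_sum path_term (R1 @ R2) = list_sum path_term R1 \<oplus> list_sum path_term R2"
    "list_sum (\<lambda>(b, e). b \<otimes> ghost e) (B1 @ B2) =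
      list_sum (\<lambda>(b, e). b \<otimes> ghost e) B1 \<oplus> list_sum (\<lambda>(b, e). b \<otimes> ghost e) B2"
    using R B by (intro list_sum_append; blast)+
  have "(a \<oplus> b) \<otimes> vert v = list_sum path_term (R1 @ R2) \<oplus> list_sum (\<lambda>(b, e). b \<otimes> ghost e) (B1 @ B2)"
    using add(1,2) assms(2) closed
    unfolding append
    by (simp add: distrib_right ghost_span_closed 1(1) 2(1) add_assoc add_left_commute)
  then show ?case using 1(2-4) 2(2-4)
    by (intro exI[of _ "R1 @ R2"] exI[of _ "B1 @ B2"]) auto
qed

text \<open>
  The sum of all \<open>e e\<^sup>*\<close> over the edges involved is a right identity for such a combination. At an
  infinite emitter this takes the place of the last relation.
\<close>

lemma ghost_sum_recover:
  assumes B: "\<And>b e. (b, e) \<in> set B \<Longrightarrow> b \<in> carrier A \<and> e \<in> arcs G"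
    and es: "distinct es" "snd ` set B = set es"
    and a: "a = list_sum (\<lambda>(b, e). b \<otimes> ghost e) B"
  shows "a = list_sum (\<lambda>e. (a \<otimes> edge e) \<otimes> ghost e) es"
proof -
  define y where "y = list_sum (\<lambda>e. edge e \<otimes> ghost e) es"
  have arcs: "e \<in> arcs G" if "e \<in> set es" for e using that B es(2) by force
  have y: "y \<in> carrier A" using arcs by (auto simp: y_def)
  have B_closed: "(case s of (b, e) \<Rightarrow> b \<otimes> ghost e) \<in> carrier A" if "s \<in> set B" for s
    using B that by (cases s) auto
  have absorb: "ghost e \<otimes> y = ghost e" if "e \<in> set es" for e
  proof -
    have "ghost e \<otimes> y = list_sum (\<lambda>f. ghost e \<otimes> (edge f \<otimes> ghost f)) es"
      unfolding y_def using arcs that by (intro mul_list_sum) auto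
    also have "\<dots> = ghost e \<otimes> (edge e \<otimes> ghost e)"
      using arcs that es(1)
      by (intro list_sum_single) (auto simp: mul_assoc[symmetric] ghost_edge zero_mul)
    also have "\<dots> = ghost e"
      using arcs[OF that] by (simp add: mul_assoc[symmetric] ghost_edge head_ghost)
    finally show ?thesis .
  qed
  have "a \<otimes> y = list_sum (\<lambda>s. (case s of (b, e) \<Rightarrow> b \<otimes> ghost e) \<otimes> y) B"
    unfolding a using B_closed y by (intro list_sum_mul)
  also have "\<dots> = a"
    unfolding a
  proof (intro list_sum_cong)
    fix s assume s: "s \<in> set B"
    obtain b e where be: "s = (b, e)" by (cases s)
    have "b \<in> carrier A" "e \<in> arcs G" "e \<in> set es" using B s es(2) be by force+
    then show "(case s of (b, e) \<Rightarrow> b \<otimes> ghost e) \<otimes> y = (case s of (b, e) \<Rightarrow> b \<otimes> ghost e)"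
      using y by (simp add: be mul_assoc absorb)
  qed
  finally have "a = a \<otimes> y" ..
  also have "\<dots> = list_sum (\<lambda>e. a \<otimes> (edge e \<otimes> ghost e)) es"
    unfolding y_def using arcs B_closed by (intro mul_list_sum) (auto simp: a)
  also have "\<dots> = list_sum (\<lambda>e. (a \<otimes> edge e) \<otimes> ghost e) es"
    using arcs B_closed by (intro list_sum_cong) (auto simp: a mul_assoc)
  finally show ?thesis .
qed

text \<open>
  Induction on the length of the ghosts. A nonzero \<open>a\<close> ending at \<open>v\<close> either has a nonzero product
  with some edge, which shortens the ghosts, or is killed by all edges leaving \<open>v\<close>. In the second
  case \<open>v\<close> is not regular, the ghost-free part of \<open>a\<close> does not vanish, and either \<open>v\<close> is a sink, so
  there is nothing else, or one of the infinitely many edges leaving \<open>v\<close> does not occur in \<open>a\<close> and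
  removes everything else.
\<close>

lemma vert_in_nonzero_ideal:
  assumes exits: "\<forall>x t. awalk x t x \<longrightarrow> t \<noteq> [] \<longrightarrow> has_exit G t"
    and I: "ideal I A"
    and a: "a \<in> I" "a \<noteq> \<zero>"
  shows "\<exists>v\<in>verts G. vert v \<in> I"
proof -
  have I_sub: "I \<subseteq> carrier A" using I by (simp add: ideal_def)
  have I_mul: "b \<otimes> c \<in> I" if "b \<in> I" "c \<in> carrier A" for b c
    using I that unfolding ideal_def by blast
  obtain n where "a \<in> ghost_span n" using in_ghost_span I_sub a by blast
  with a show ?thesis
  proof (induction n arbitrary: a)
    case 0
    then obtain v where v: "v \<in> verts G" "a \<otimes> vert v \<noteq> \<zero>" using nonzero_at_vertex I_sub by blast
    obtain R where R: "a \<otimes> vert v = list_sum path_term R \<oplus> \<zero>" "\<forall>(k, u, p)\<in>set R. awalk u p v"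
      using ghost_span_at_vert[OF 0(3) v(1)] by auto
    have R_closed: "path_term s \<in> carrier A" if "s \<in> set R" for s using path_term_closed[OF that, of v] R(2) by blast
    then have eq: "a \<otimes> vert v = list_sum path_term R" using R(1) by simp
    moreover have "a \<otimes> vert v \<in> I" using I_mul 0(1) v(1) by blast
    moreover have "(a \<otimes> vert v) \<otimes> vert v = a \<otimes> vert v"
      using v(1) 0(1) I_sub by (auto simp: mul_assoc vert_vert)
    ultimately have "list_sum path_term R \<otimes> path v [] \<in> I" by simp
    then show ?case
      using vert_of_extended_path_combination[OF exits I, where R = R and x = v and q = "[]" and y = v]
        v R(2) eq by (auto simp: awalk_simps)
  next
    case (Suc n)
    then have a: "a \<in> carrier A" using I_sub by blast
    obtain v where v: "v \<in> verts G" "a \<otimes> vert v \<noteq> \<zero>" using nonzero_at_vertex[OF a Suc.prems(2)] .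
    define b where "b = a \<otimes> vert v"
    have b: "b \<in> carrier A" "b \<noteq> \<zero>" "b \<in> I" using a v I_mul Suc.prems(1) by (auto simp: b_def)
    have bv: "b \<otimes> vert v = b" using a v(1) by (simp add: b_def mul_assoc vert_vert)
    show ?case
    proof (cases "\<exists>e\<in>out_arcs G v. b \<otimes> edge e \<noteq> \<zero>")
      case True
      then obtain e where e: "e \<in> arcs G" "tail G e = v" "b \<otimes> edge e \<noteq> \<zero>" by auto
      have "b \<in> ghost_span (Suc n)" unfolding b_def using Suc.prems v by (intro ghost_span_mul_vert)
      then have "b \<otimes> edge e \<in> ghost_span n" using e by (intro ghost_span_mul_edge)
      moreover have "b \<otimes> edge e \<in> I" using I_mul b e by auto
      ultimately show ?thesis using Suc.IH e(3) by blast
    next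
      case False
      then have killed: "b \<otimes> edge e = \<zero>" if "e \<in> out_arcs G v" for e using that by blast
      obtain R B where b_eq: "b = list_sum path_term R \<oplus> list_sum (\<lambda>(b, e). b \<otimes> ghost e) B"
        and R: "\<forall>(k, u, p)\<in>set R. awalk u p v"
        and B: "\<forall>(b, e)\<in>set B. b \<in> carrier A \<and> e \<in> out_arcs G v"
        using ghost_span_at_vert[OF Suc.prems(3) v(1)] unfolding b_def by blast
      have R_closed: "list_sum path_term R \<in> carrier A"
      proof (intro list_sum_closed)
        fix s assume "s \<in> set R"
        then show "path_term s \<in> carrier A" using path_term_closed[of s R v] R by blast
      qed
      have B_closed: "(case s of (b, e) \<Rightarrow> b \<otimes> ghost e) \<in> carrier A" if "s \<in> set B" for s
        using B that by (cases s) auto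
      have killed_ghost: "list_sum (\<lambda>e. (b \<otimes> edge e) \<otimes> ghost e) es = \<zero>" if "set es \<subseteq> out_arcs G v" for es
        using that killed by (intro list_sum_zero) (auto simp: zero_mul)
      have R_nonzero: "list_sum path_term R \<noteq> \<zero>"
      proof
        assume "list_sum path_term R = \<zero>"
        then have "b = list_sum (\<lambda>(b, e). b \<otimes> ghost e) B" using b_eq B_closed by simp
        moreover obtain es where "set es = snd ` set B" "distinct es"
          using finite_distinct_list[of "snd ` set B"] by auto
        ultimately have "b = list_sum (\<lambda>e. (b \<otimes> edge e) \<otimes> ghost e) es"
          using B by (intro ghost_sum_recover) auto
        moreover have "set es \<subseteq> out_arcs G v" using B \<open>set es = snd ` set B\<close> by auto
        ultimately show False using killed_ghost b(2) by simp
      qed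
      have "\<not> regular_vertex G v"
      proof
        assume reg: "regular_vertex G v"
        then obtain es where es: "set es = out_arcs G v" "distinct es"
          using finite_distinct_list by (auto simp: regular_vertex_def)
        have arcs: "e \<in> arcs G" if "e \<in> set es" for e using that es by auto
        have "b = b \<otimes> list_sum (\<lambda>e. edge e \<otimes> ghost e) es"
          using vert_regular[OF reg es(2,1)] bv by simp
        also have "\<dots> = list_sum (\<lambda>e. b \<otimes> (edge e \<otimes> ghost e)) es"
          using arcs b(1) by (intro mul_list_sum) auto
        also have "\<dots> = list_sum (\<lambda>e. (b \<otimes> edge e) \<otimes> ghost e) es"
          using arcs b(1) by (intro list_sum_cong) (simp add: mul_assoc)
        finally show False using killed_ghost[of es] es(1) b(2) by simp
      qed
      then consider "out_arcs G v = {}" | "infinite (out_arcs G v)"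
        using v(1) by (auto simp: regular_vertex_def)
      then show ?thesis
      proof cases
        case 1
        then have "B = []" using B by (cases B) auto
        then have "b = list_sum path_term R" using b_eq R_closed by simp
        then have "list_sum path_term R \<otimes> path v [] \<in> I" using b(3) bv by simp
        then show ?thesis
          using vert_of_extended_path_combination[OF exits I, where R = R and x = v and q = "[]" and y = v]
            v R R_nonzero by (auto simp: awalk_simps)
      next
        case 2
        then obtain f where f: "f \<in> out_arcs G v" "f \<notin> snd ` set B"
          by (metis finite_imageI List.finite_set infinite_super subsetI)
        have "list_sum (\<lambda>(b, e). b \<otimes> ghost e) B \<otimes> edge f =
            list_sum (\<lambda>s. (case s of (b, e) \<Rightarrow> b \<otimes> ghost e) \<otimes> edge f) B"
          using B_closed f by (intro list_sum_mul) auto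
        also have "\<dots> = \<zero>"
        proof (intro list_sum_zero)
          fix s assume s: "s \<in> set B"
          obtain c e where ce: "s = (c, e)" by (cases s)
          have "c \<in> carrier A" "e \<in> arcs G" "e \<noteq> f" using B s f ce by force+
          then show "(case s of (b, e) \<Rightarrow> b \<otimes> ghost e) \<otimes> edge f = \<zero>"
            using f by (simp add: ce mul_assoc ghost_edge mul_zero)
        qed
        finally have "b \<otimes> edge f = list_sum path_term R \<otimes> edge f"
          using b_eq R_closed B_closed f by (simp add: distrib_right list_sum_closed)
        moreover have "path v [f] = edge f" using f by (simp add: edge_head)
        moreover have "b \<otimes> edge f \<in> I" using I_mul b f by auto
        ultimately have "list_sum path_term R \<otimes> path v [f] \<in> I" by simp
        then show ?thesis
          using vert_of_extended_path_combination[OF exits I, where R = R and x = v and q = "[f]"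
              and y = "head G f"] f R R_nonzero by (auto simp: awalk_simps)
      qed
    qed
  qed
qed


section \<open>Sufficiency of the two conditions\<close>

lemma ideal_verts_hereditary:
  assumes "ideal I A" shows "hereditary G {v \<in> verts G. vert v \<in> I}"
  unfolding hereditary_def
proof clarsimp
  fix e assume e: "e \<in> arcs G" "vert (tail G e) \<in> I"
  have "ghost e \<otimes> (vert (tail G e) \<otimes> edge e) \<in> I"
    using assms e unfolding ideal_def by blast
  then show "vert (head G e) \<in> I" using e by (simp add: tail_edge ghost_edge)
qed

lemma ideal_verts_saturated:
  assumes I: "ideal I A" shows "saturated G {v \<in> verts G. vert v \<in> I}"
  unfolding saturated_def
proof (intro allI impI; elim conjE)
  fix v assume v: "regular_vertex G v" "head G ` out_arcs G v \<subseteq> {v \<in> verts G. vert v \<in> I}"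
  then obtain es where es: "set es = out_arcs G v" "distinct es"
    using finite_distinct_list[of "out_arcs G v"] unfolding regular_vertex_def by blast
  have "edge e \<otimes> ghost e \<in> I" if "e \<in> set es" for e
  proof -
    have "e \<in> out_arcs G v" using that es by simp
    moreover from this have "head G e \<in> {v \<in> verts G. vert v \<in> I}" using v(2) by blast
    ultimately have e: "e \<in> arcs G" "vert (head G e) \<in> I" by simp_all
    then have "edge e \<otimes> (vert (head G e) \<otimes> ghost e) \<in> I" using I unfolding ideal_def by blast
    then show ?thesis using e by (simp add: head_ghost)
  qed
  then have "list_sum (\<lambda>e. edge e \<otimes> ghost e) es \<in> I" by (rule ideal_list_sum[OF I])
  then show "v \<in> {v \<in> verts G. vert v \<in> I}"
    using vert_regular[OF v(1) es(2,1)] v(1) by (auto simp: regular_vertex_def)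
qed

lemma ideal_with_all_verts:
  assumes I: "ideal I A" and all: "\<And>v. v \<in> verts G \<Longrightarrow> vert v \<in> I"
  shows "I = carrier A"
proof
  show "I \<subseteq> carrier A" using I by (simp add: ideal_def)
  have I_mul: "b \<otimes> c \<in> I" and I_mul': "c \<otimes> b \<in> I" if "b \<in> I" "c \<in> carrier A" for b c
    using I that unfolding ideal_def by blast+
  have "a \<in> I" if "a \<in> ghost_span n" for a n
    using that
  proof (induction rule: ghost_span.induct)
    case (mono u p x w q k)
    have x: "x \<in> verts G" using mono by auto
    have closed: "path u p \<in> carrier A" "ghost_path w q \<in> carrier A" using mono by auto
    \<comment> \<open>The scalar is moved to the vertex in the middle, since ideals of hemirings need not be
      closed under scalar multiplication.\<close>
    have "k \<odot> (path u p \<otimes> ghost_path w q) = path u p \<otimes> (((k \<odot> vert x) \<otimes> vert x) \<otimes> ghost_path w q)"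
      using x closed by (simp add: smult_mul_left smult_mul_right vert_vert vert_ghost_path[OF mono(2)])
    also have "\<dots> \<in> I"
      using I_mul'[OF I_mul[OF I_mul'[OF all[OF x] smult_closed[OF vert_closed[OF x], of k]] closed(2)] closed(1)] .
    finally show ?case .
  qed (use I in \<open>auto simp: ideal_def\<close>)
  then show "carrier A \<subseteq> I" using in_ghost_span by blast
qed

theorem ideal_simple_if:
  assumes trivial: "{H. H \<subseteq> verts G \<and> hereditary G H \<and> saturated G H} = {{}, verts G}"
    and exits: "\<forall>c. cycle c \<longrightarrow> has_exit G c"
  shows "ideal_simple A"
proof -
  have "I = carrier A" if I: "ideal I A" "I \<noteq> {\<zero>}" for I
  proof -
    let ?H = "{v \<in> verts G. vert v \<in> I}"
    obtain a where "a \<in> I" "a \<noteq> \<zero>" using I by (auto simp: ideal_def)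
    then have "?H \<noteq> {}"
      using vert_in_nonzero_ideal[OF _ I(1)] closed_walk_has_exit exits by (metis (lifting) empty_Collect_eq)
    moreover have "?H \<in> {H. H \<subseteq> verts G \<and> hereditary G H \<and> saturated G H}"
      using ideal_verts_hereditary[OF I(1)] ideal_verts_saturated[OF I(1)] by blast
    ultimately have "?H = verts G" unfolding trivial by blast
    then show ?thesis using ideal_with_all_verts[OF I(1)] by blast
  qed
  moreover have "ideal {\<zero>} A" "ideal (carrier A) A"
    by (auto simp: ideal_def mul_zero zero_mul)
  ultimately show ?thesis unfolding ideal_simple_def by blast
qed

end


section \<open>The Leavitt path algebra as a Leavitt family\<close>

lemma presented_algebra_class_eq:
  assumes "(t, u) \<in> \<R>" "t \<in> alg_terms X" "u \<in> alg_terms X"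
  shows "alg_cong X \<R> `` {t} = alg_cong X \<R> `` {u}"
  using assms by (simp add: alg_class_eq_iff alg_cong.base)

lemma leavitt_family_leavitt_path_algebra:
  fixes G :: "('v, 'e) pre_digraph"
  assumes "wf_digraph G"
  defines "c \<equiv> \<lambda>t :: ('s::semifield, ('v, 'e) leavitt_gen) alg_term.
    alg_cong (leavitt_gens G) (leavitt_relations G) `` {t}"
  shows "leavitt_family (leavitt_path_algebra TYPE('s) G) G
    (\<lambda>v. c (Gen (Vertex v))) (\<lambda>e. c (Gen (Edge e))) (\<lambda>e. c (Gen (Ghost e)))"
proof -
  define X where "X = leavitt_gens G"
  define \<R> where "\<R> = (leavitt_relations G ::
    (('s, ('v, 'e) leavitt_gen) alg_term \<times> ('s, ('v, 'e) leavitt_gen) alg_term) set)"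
  define A where "A = presented_algebra X \<R>"
  interpret wf_digraph G by fact
  interpret A: algebra A unfolding A_def by (rule algebra_presented_algebra)
  have c: "c t = alg_cong X \<R> `` {t}" for t by (simp add: c_def X_def \<R>_def)
  note simps = presented_algebra_simps[where X = X and \<R> = \<R>, folded A_def c]
  have gens: "v \<in> verts G \<Longrightarrow> Vertex v \<in> X" "e \<in> arcs G \<Longrightarrow> Edge e \<in> X"
    "e \<in> arcs G \<Longrightarrow> Ghost e \<in> X" for v e
    by (auto simp: X_def leavitt_gens_def)
  have rel: "c t = c u" if "(t, u) \<in> leavitt_relations G" "t \<in> alg_terms X" "u \<in> alg_terms X" for t u
    using presented_algebra_class_eq[of t u \<R> X] that by (simp add: c \<R>_def)
  have closed: "c t \<in> carrier A" if "t \<in> alg_terms X" for t using simps(1) that by blast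
  let ?ee = "\<lambda>e t. Plus (Times (Gen (Edge e)) (Gen (Ghost e))) (t :: ('s, ('v, 'e) leavitt_gen) alg_term)"
  have sum: "foldr ?ee es Zero \<in> alg_terms X \<and> c (foldr ?ee es Zero) =
      A.list_sum (\<lambda>e. mul A (c (Gen (Edge e))) (c (Gen (Ghost e)))) es" if "set es \<subseteq> arcs G" for es
    using that
  proof (induction es)
    case (Cons e es)
    then have "foldr ?ee es Zero \<in> alg_terms X"
      and sum: "A.list_sum (\<lambda>e. mul A (c (Gen (Edge e))) (c (Gen (Ghost e)))) es = c (foldr ?ee es Zero)"
      using Cons.IH by auto
    then show ?case using Cons.prems by (simp add: sum simps gens)
  qed (simp add: simps)
  have "leavitt_family A G
    (\<lambda>v. c (Gen (Vertex v))) (\<lambda>e. c (Gen (Edge e))) (\<lambda>e. c (Gen (Ghost e)))"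
  proof unfold_locales
    fix v es assume v: "regular_vertex G v" "distinct es" "set es = out_arcs G v"
    then have "set es \<subseteq> arcs G" "v \<in> verts G" by (auto simp: regular_vertex_def)
    then show "c (Gen (Vertex v)) =
        A.list_sum (\<lambda>e. mul A (c (Gen (Edge e))) (c (Gen (Ghost e)))) es"
      using sum[of es] rel[OF leavitt_relations.regular[OF v]] gens by simp
  next
    fix x P
    assume x: "x \<in> carrier A"
      and gen: "\<And>v. v \<in> verts G \<Longrightarrow> P (c (Gen (Vertex v)))" "\<And>e. e \<in> arcs G \<Longrightarrow> P (c (Gen (Edge e)))"
        "\<And>e. e \<in> arcs G \<Longrightarrow> P (c (Gen (Ghost e)))"
      and ops: "P (zero A)"
        "\<And>y z. y \<in> carrier A \<Longrightarrow> z \<in> carrier A \<Longrightarrow> P y \<Longrightarrow> P z \<Longrightarrow> P (add A y z)"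
        "\<And>y z. y \<in> carrier A \<Longrightarrow> z \<in> carrier A \<Longrightarrow> P y \<Longrightarrow> P z \<Longrightarrow> P (mul A y z)"
        "\<And>k y. y \<in> carrier A \<Longrightarrow> P y \<Longrightarrow> P (smult A k y)"
    have "P (c t)" if "t \<in> alg_terms X" for t
      using that
    proof (induction t)
      case (Gen g)
      then show ?case using gen by (auto simp: X_def leavitt_gens_def)
    next
      case Zero
      then show ?case using ops(1) by (simp add: simps)
    next
      case (Plus t u)
      then show ?case using ops(2)[of "c t" "c u"] closed by (simp add: simps)
    next
      case (Times t u)
      then show ?case using ops(3)[of "c t" "c u"] closed by (simp add: simps)
    next
      case (Scale k t)
      then show ?case using ops(4)[of "c t" k] closed by (simp add: simps)
    qed
    then show "P x" using x by (auto simp: simps(1))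
  next
    fix v w assume "v \<in> verts G" "w \<in> verts G"
    then show "mul A (c (Gen (Vertex v))) (c (Gen (Vertex w))) =
        (if v = w then c (Gen (Vertex v)) else zero A)"
      using rel[OF leavitt_relations.vertex_vertex, of v w] by (auto simp: simps gens)
  next
    fix e f assume "e \<in> arcs G" "f \<in> arcs G"
    then show "mul A (c (Gen (Ghost e))) (c (Gen (Edge f))) =
        (if e = f then c (Gen (Vertex (head G e))) else zero A)"
      using rel[OF leavitt_relations.ghost_edge, of e f] by (auto simp: simps gens)
  qed (simp_all add: simps gens closed rel leavitt_relations.intros)
  then show ?thesis by (simp add: A_def X_def \<R>_def leavitt_path_algebra_def)
qed


section \<open>Ideals detected by a representation\<close>

text \<open>
  A set of values of a representation that is closed under the action of the generators pulls back
  to an ideal, since everything is built from the generators.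
\<close>

lemma ideal_of_representation:
  assumes B: "algebra B" and f: "f ` X \<subseteq> carrier B"
    and rel: "\<And>t u. (t, u) \<in> \<R> \<Longrightarrow> t \<in> alg_terms X \<Longrightarrow> u \<in> alg_terms X \<Longrightarrow>
      alg_eval B f t = alg_eval B f u"
    and J: "J \<subseteq> carrier B" "zero B \<in> J" "\<And>S T. S \<in> J \<Longrightarrow> T \<in> J \<Longrightarrow> add B S T \<in> J"
      "\<And>k T. T \<in> J \<Longrightarrow> smult B k T \<in> J"
      "\<And>x T. x \<in> X \<Longrightarrow> T \<in> J \<Longrightarrow> mul B (f x) T \<in> J \<and> mul B T (f x) \<in> J"
  defines "c \<equiv> \<lambda>t. alg_cong X \<R> `` {t}"
  defines "I \<equiv> c ` {t \<in> alg_terms X. alg_eval B f t \<in> J}"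
  shows "ideal I (presented_algebra X \<R>)"
    and "t \<in> alg_terms X \<Longrightarrow> c t \<in> I \<longleftrightarrow> alg_eval B f t \<in> J"
proof -
  interpret algebra B by fact
  have c: "c t = alg_cong X \<R> `` {t}" for t by (simp add: c_def)
  note simps = presented_algebra_simps[where X = X and \<R> = \<R>, folded c]
  note eval_closed = alg_eval_closed[OF f]
  show iff: "c t \<in> I \<longleftrightarrow> alg_eval B f t \<in> J" if t: "t \<in> alg_terms X" for t
  proof
    assume "c t \<in> I"
    then obtain u where u: "u \<in> alg_terms X" "alg_eval B f u \<in> J" "c t = c u" by (auto simp: I_def)
    then have "(t, u) \<in> alg_cong X \<R>" using t by (simp add: c_def alg_class_eq_iff)
    then show "alg_eval B f t \<in> J" using alg_eval_cong[OF f rel] u(2) by metis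
  qed (use t in \<open>auto simp: I_def\<close>)
  have absorb: "mul B (alg_eval B f t) T \<in> J \<and> mul B T (alg_eval B f t) \<in> J"
    if "t \<in> alg_terms X" "T \<in> J" for t T
    using that
  proof (induction t arbitrary: T)
    case (Gen x)
    then show ?case using J(5) by simp
  next
    case Zero
    then show ?case using J(1,2) by (auto simp: zero_mul mul_zero)
  next
    case (Plus t u)
    then have "T \<in> carrier B" using J(1) by blast
    then show ?case using Plus J(3) by (simp add: distrib_left distrib_right eval_closed)
  next
    case (Times t u)
    then have T: "T \<in> carrier B" using J(1) by blast
    have "mul B (alg_eval B f t) (mul B (alg_eval B f u) T) \<in> J"
      "mul B (mul B T (alg_eval B f t)) (alg_eval B f u) \<in> J"
      using Times by simp_all
    then show ?case using Times.prems T by (simp add: mul_assoc eval_closed)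
  next
    case (Scale k t)
    then have "T \<in> carrier B" using J(1) by blast
    then show ?case using Scale J(4) by (simp add: smult_mul_left smult_mul_right eval_closed)
  qed
  show "ideal I (presented_algebra X \<R>)"
    unfolding ideal_def
  proof (intro conjI ballI)
    show "I \<subseteq> carrier (presented_algebra X \<R>)" by (auto simp: I_def simps)
    show "zero (presented_algebra X \<R>) \<in> I" using iff[of Zero] J(2) by (simp add: simps)
  next
    fix a b assume "a \<in> I" "b \<in> I"
    then obtain t u where tu: "a = c t" "b = c u" "t \<in> alg_terms X" "u \<in> alg_terms X"
      "alg_eval B f t \<in> J" "alg_eval B f u \<in> J" by (auto simp: I_def)
    then show "add (presented_algebra X \<R>) a b \<in> I"
      using iff[of "Plus t u"] J(3) by (simp add: simps)
  next
    fix a x assume "a \<in> I" "x \<in> carrier (presented_algebra X \<R>)"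
    then obtain t u where tu: "a = c t" "x = c u" "t \<in> alg_terms X" "u \<in> alg_terms X"
      "alg_eval B f t \<in> J" by (auto simp: I_def simps)
    then show "mul (presented_algebra X \<R>) x a \<in> I" "mul (presented_algebra X \<R>) a x \<in> I"
      using iff[of "Times t u"] iff[of "Times u t"] absorb by (simp_all add: simps)
  qed
qed

definition operators :: "('s::comm_semiring_1, ('b \<Rightarrow> 's) \<Rightarrow> 'b \<Rightarrow> 's) algebra" where
  "operators =
    \<lparr> carrier = {T. (\<forall>f g. T (\<lambda>b. f b + g b) = (\<lambda>b. T f b + T g b))
        \<and> (\<forall>k f. T (\<lambda>b. k * f b) = (\<lambda>b. k * T f b))},
      add = (\<lambda>S T f b. S f b + T f b),
      mul = (\<lambda>S T f. S (T f)),
      zero = (\<lambda>f b. 0),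
      smult = (\<lambda>k T f b. k * T f b) \<rparr>"

lemma operators_simps [simp]:
  "add operators S T = (\<lambda>f b. S f b + T f b)"
  "mul operators S T = (\<lambda>f. S (T f))"
  "zero operators = (\<lambda>f b. 0)"
  "smult operators k T = (\<lambda>f b. k * T f b)"
  by (simp_all add: operators_def)

lemma operatorI:
  assumes "\<And>f g. T (\<lambda>b. f b + g b) = (\<lambda>b. T f b + T g b)" "\<And>k f. T (\<lambda>b. k * f b) = (\<lambda>b. k * T f b)"
  shows "T \<in> carrier operators"
  using assms by (simp add: operators_def)

lemma operator_add: "T \<in> carrier operators \<Longrightarrow> T (\<lambda>b. f b + g b) = (\<lambda>b. T f b + T g b)"
  and operator_scale: "T \<in> carrier operators \<Longrightarrow> T (\<lambda>b. k * f b) = (\<lambda>b. k * T f b)"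
  by (simp_all add: operators_def)

lemma operator_zero: "T \<in> carrier operators \<Longrightarrow> T (\<lambda>b. 0) = (\<lambda>b. 0)"
  using operator_scale[of T 0 "\<lambda>b. 0"] by simp

lemma algebra_operators: "algebra operators"
  by unfold_locales
    (auto simp: operator_add operator_scale operator_zero algebra_simps intro!: operatorI)

text \<open>The operators of interest permute the coordinates partially.\<close>

definition pull :: "('b \<Rightarrow> 'b option) \<Rightarrow> ('b \<Rightarrow> 's::comm_semiring_1) \<Rightarrow> 'b \<Rightarrow> 's" where
  "pull g f b = (case g b of None \<Rightarrow> 0 | Some a \<Rightarrow> f a)"

lemma pull_operator [simp]: "pull g \<in> carrier operators"
  by (auto simp: pull_def fun_eq_iff split: option.splits intro!: operatorI)

lemma pull_pull: "pull g (pull h f) = pull (\<lambda>b. Option.bind (g b) h) f"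
  by (auto simp: pull_def fun_eq_iff split: option.splits)

lemma pull_None: "pull (\<lambda>b. None) = (\<lambda>f b. 0)"
  by (simp add: pull_def fun_eq_iff)


section \<open>Branching representations\<close>

text \<open>
  A representation that kills exactly the vertices of a hereditary saturated set \<open>H\<close>. To every
  other vertex belongs a copy of the same set \<open>'e list \<times> nat\<close>, which has to split into copies for
  the edges leaving a regular vertex and to contain disjoint copies for the edges leaving any other
  vertex. The natural number serves the first purpose, by division with remainder, and the list
  serves the second one. Edges into \<open>H\<close> act as zero. Saturation ensures that at a regular vertex
  outside \<open>H\<close> the divisor is positive. The integer component records degrees: edges raise it by one.
\<close>

type_synonym ('v, 'e) state = "('v \<times> 'e list \<times> nat) \<times> int"

locale branching = wf_digraph G
  for G :: "('v, 'e) pre_digraph" +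
  fixes H :: "'v set"
  assumes hereditary: "hereditary G H" and saturated: "saturated G H"
begin

definition live :: "'v \<Rightarrow> 'e set" where
  "live v = {e \<in> out_arcs G v. head G e \<notin> H}"

definition index :: "'e \<Rightarrow> nat" where
  "index e = (SOME i. bij_betw i (live (tail G e)) {..<card (live (tail G e))}) e"

lemma live_tail: "e \<in> live v \<Longrightarrow> v \<notin> H \<and> tail G e = v \<and> e \<in> arcs G \<and> head G e \<notin> H"
  using hereditary by (auto simp: live_def hereditary_def)

lemma finite_live: "regular_vertex G v \<Longrightarrow> finite (live v)"
  unfolding regular_vertex_def live_def by (metis (lifting) finite_subset mem_Collect_eq subsetI)

lemma bij_betw_index:
  assumes "regular_vertex G v"
  shows "bij_betw index (live v) {..<card (live v)}"
proof -
  have "finite (live v)" using assms by (simp add: finite_live)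
  then obtain i where "bij_betw i (live v) {..<card (live v)}"
    using ex_bij_betw_finite_nat lessThan_atLeast0 by metis
  then have "bij_betw (SOME i. bij_betw i (live v) {..<card (live v)}) (live v) {..<card (live v)}"
    by (rule someI[of "\<lambda>i. bij_betw i (live v) {..<card (live v)}"])
  moreover have "index e = (SOME i. bij_betw i (live v) {..<card (live v)}) e" if "e \<in> live v" for e
    using live_tail[OF that] by (simp add: index_def)
  ultimately show ?thesis by (metis (no_types, lifting) bij_betw_cong)
qed

lemma card_live_pos:
  assumes "regular_vertex G v" "v \<notin> H" shows "0 < card (live v)"
proof -
  have "finite (live v)" using assms by (simp add: finite_live)
  moreover have "live v \<noteq> {}"
    using assms saturated unfolding live_def saturated_def by blast
  ultimately show ?thesis by (simp add: card_gt_0_iff)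
qed

fun stay :: "'v \<Rightarrow> ('v, 'e) state \<Rightarrow> ('v, 'e) state option" where
  "stay v ((u, l, k), m) = (if u = v \<and> v \<notin> H then Some ((u, l, k), m) else None)"

fun forward :: "'e \<Rightarrow> ('v, 'e) state \<Rightarrow> ('v, 'e) state option" where
  "forward e ((u, l, k), m) =
    (if e \<in> live (tail G e) \<and> u = head G e
     then Some (if regular_vertex G (tail G e)
       then ((tail G e, l, card (live (tail G e)) * k + index e), m + 1)
       else ((tail G e, e # l, k), m + 1))
     else None)"

fun backward :: "'e \<Rightarrow> ('v, 'e) state \<Rightarrow> ('v, 'e) state option" where
  "backward e ((u, l, k), m) =
    (if e \<in> live (tail G e) \<and> u = tail G e
     then if regular_vertex G (tail G e)
       then if k mod card (live u) = index e
         then Some ((head G e, l, k div card (live u)), m - 1) else None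
       else (case l of [] \<Rightarrow> None | f # l' \<Rightarrow> if f = e then Some ((head G e, l', k), m - 1) else None)
     else None)"

primrec rep :: "('v, 'e) leavitt_gen \<Rightarrow> (('v, 'e) state \<Rightarrow> 's) \<Rightarrow> ('v, 'e) state \<Rightarrow> 's::comm_semiring_1"
where
  "rep (Vertex v) = pull (stay v)"
| "rep (Edge e) = pull (backward e)"
| "rep (Ghost e) = pull (forward e)"

lemma rep_operator [simp]: "rep x \<in> carrier operators"
  by (cases x) auto

lemma index_less:
  assumes "e \<in> live v" "regular_vertex G v" shows "index e < card (live v)"
  using bij_betw_index[OF assms(2)] assms(1) by (auto simp: bij_betw_def)

lemma index_inj:
  assumes "e \<in> live v" "f \<in> live v" "regular_vertex G v" "index e = index f"
  shows "e = f"
  using bij_betw_index[OF assms(3)] assms by (auto simp: bij_betw_def inj_on_def)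

lemma backward_forward:
  assumes "e \<in> arcs G" "f \<in> arcs G"
  shows "Option.bind (forward e b) (backward f) = (if e = f then stay (head G e) b else None)"
proof -
  obtain u l k m where b: "b = ((u, l, k), m)" by (metis prod.exhaust)
  show ?thesis
  proof (cases "e \<in> live (tail G e) \<and> u = head G e")
    case True
    then have e: "e \<in> live (tail G e)" "u = head G e" "head G e \<notin> H" by (auto simp: live_def)
    consider "e = f" | "e \<noteq> f" "f \<in> live (tail G e)" "tail G f = tail G e"
      | "\<not> (f \<in> live (tail G f) \<and> tail G e = tail G f)" using e(1) by metis
    then show ?thesis
    proof cases
      case 1
      then show ?thesis using e index_less[OF e(1)]
        by (cases "regular_vertex G (tail G e)") (simp_all add: b)
    next
      case 2
      show ?thesis
      proof (cases "regular_vertex G (tail G e)")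
        case reg: True
        have "index e \<noteq> index f" using index_inj[OF e(1) 2(2) reg] 2(1) by blast
        then show ?thesis using 2 e reg index_less[OF e(1) reg] by (simp add: b)
      next
        case False
        then show ?thesis using 2 e by (simp add: b)
      qed
    next
      case 3
      then have "e \<noteq> f" using e(1) by metis
      moreover have "backward f ((tail G e, l', k'), m') = None" for l' k' m'
        unfolding backward.simps using 3 by (subst if_not_P) blast+
      ultimately show ?thesis using e
        by (cases "regular_vertex G (tail G e)") (simp_all add: b del: backward.simps)
    qed
  next
    case False
    then have "forward e b = None" by (simp add: b)
    moreover have "stay (head G e) b = None" using False assms(1) by (auto simp: b live_def)
    ultimately show ?thesis by auto
  qed
qed

lemma forward_backward:
  assumes "regular_vertex G (tail G e)"
  shows "Option.bind (backward e ((u, l, k), m)) (forward e) =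
    (if e \<in> live u \<and> tail G e = u \<and> k mod card (live u) = index e then Some ((u, l, k), m) else None)"
proof (cases "e \<in> live (tail G e) \<and> u = tail G e")
  case True
  have "k mod n = index e \<Longrightarrow> n * (k div n) + index e = k" for n
    using mult_div_mod_eq[of n k] by simp
  then show ?thesis using True assms by auto
next
  case False
  then have "backward e ((u, l, k), m) = None" unfolding backward.simps by (rule if_not_P)
  then show ?thesis using False by auto
qed

text \<open>
  The remainder of the natural number in a state at \<open>v\<close> selects the only edge whose copy contains
  this state.
\<close>

lemma rep_regular:
  assumes "regular_vertex G v" "distinct es" "set es = out_arcs G v"
  shows "pull (stay v) = (\<lambda>f b. \<Sum>e\<leftarrow>es. pull (backward e) (pull (forward e) f) b)"
proof (intro ext)
  fix f :: "('v, 'e) state \<Rightarrow> 's::comm_semiring_1" and b :: "('v, 'e) state"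
  obtain u l k m where b: "b = ((u, l, k), m)" by (metis prod.exhaust)
  have summand: "pull (backward e) (pull (forward e) f) b =
      (if u = v \<and> e \<in> live v \<and> index e = k mod card (live v) then f b else 0)" if "e \<in> set es" for e
  proof -
    have "tail G e = v" using assms(3) that by auto
    then show ?thesis using forward_backward[of e u l k m] assms(1)
      by (auto simp: pull_pull pull_def b)
  qed
  have sub: "live v \<subseteq> set es" using assms(3) by (auto simp: live_def)
  have "(\<Sum>e\<leftarrow>es. pull (backward e) (pull (forward e) f) b) =
      (\<Sum>e\<in>set es. if u = v \<and> e \<in> live v \<and> index e = k mod card (live v) then f b else 0)"
    using assms(2) summand by (simp add: sum_list_distinct_conv_sum_set)
  also have "\<dots> = (if u = v \<and> v \<notin> H then f b else 0)"
  proof (cases "u = v \<and> v \<notin> H")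
    case True
    then have "k mod card (live v) < card (live v)" using card_live_pos assms(1) by simp
    then obtain e where e: "e \<in> live v" "index e = k mod card (live v)"
      using bij_betw_index[OF assms(1)] by (auto simp: bij_betw_def image_iff set_eq_iff) metis
    then have "(\<Sum>e\<in>set es. if u = v \<and> e \<in> live v \<and> index e = k mod card (live v) then f b else 0) =
        (\<Sum>e'\<in>set es. if e' = e then f b else 0)"
      using True index_inj[OF _ _ assms(1)] by (intro sum.cong) auto
    then show ?thesis using e(1) sub True by (auto simp: sum.delta)
  next
    case False
    then show ?thesis using live_tail by (auto intro!: sum.neutral)
  qed
  also have "\<dots> = pull (stay v) f b" by (auto simp: pull_def b)
  finally show "pull (stay v) f b = (\<Sum>e\<leftarrow>es. pull (backward e) (pull (forward e) f) b)" ..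
qed

lemma rep_relations:
  assumes "(t, u) \<in> (leavitt_relations G ::
    (('s::comm_semiring_1, ('v, 'e) leavitt_gen) alg_term \<times> _) set)"
  shows "alg_eval operators rep t = alg_eval operators rep u"
  using assms
proof cases
  case (vertex_vertex v w)
  have "Option.bind (stay v b) (stay w) = (if v = w then stay v b else None)" for b
    by (cases "(v, b)" rule: stay.cases) auto
  then show ?thesis using vertex_vertex by (auto simp: pull_pull fun_eq_iff pull_def)
next
  case (source_edge e)
  have "Option.bind (stay (tail G e) b) (backward e) = backward e b" for b
    by (cases "(e, b)" rule: backward.cases) (auto dest: live_tail)
  then show ?thesis using source_edge by (simp add: pull_pull fun_eq_iff)
next
  case (edge_range e)
  have "Option.bind (backward e b) (stay (head G e)) = backward e b" for b
    by (cases "(e, b)" rule: backward.cases) (auto dest: live_tail split: list.splits)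
  then show ?thesis using edge_range by (simp add: pull_pull fun_eq_iff)
next
  case (range_ghost e)
  have "Option.bind (stay (head G e) b) (forward e) = forward e b" for b
    by (cases "(e, b)" rule: backward.cases) (auto dest: live_tail)
  then show ?thesis using range_ghost by (simp add: pull_pull fun_eq_iff)
next
  case (ghost_source e)
  have "Option.bind (forward e b) (stay (tail G e)) = forward e b" for b
    by (cases "(e, b)" rule: backward.cases) (auto dest: live_tail)
  then show ?thesis using ghost_source by (simp add: pull_pull fun_eq_iff)
next
  case (ghost_edge e f)
  then show ?thesis by (auto simp: pull_pull fun_eq_iff backward_forward pull_None)
next
  case (regular v es)
  have "alg_eval operators rep (foldr (\<lambda>e t. Plus (Times (Gen (Edge e)) (Gen (Ghost e))) t) es Zero) =
      (\<lambda>f b. \<Sum>e\<leftarrow>es. pull (backward e) (pull (forward e) f) (b :: ('v, 'e) state) :: 's)" for es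
    by (induction es) auto
  then show ?thesis using regular rep_regular by simp
qed

end


section \<open>Necessity of the two conditions\<close>

lemma empty_hereditary: "hereditary G {}"
  and empty_saturated: "saturated G {}"
  by (auto simp: hereditary_def saturated_def regular_vertex_def)

context branching
begin

abbreviation leavitt_class ::
    "('s::comm_semiring_1, ('v, 'e) leavitt_gen) alg_term \<Rightarrow> ('s, ('v, 'e) leavitt_gen) alg_term set"
  where "leavitt_class t \<equiv> alg_cong (leavitt_gens G) (leavitt_relations G) `` {t}"

lemma rep_image: "rep ` leavitt_gens G \<subseteq> carrier operators"
  by auto

lemma class_neq_zero:
  assumes "alg_eval operators rep t \<noteq> (\<lambda>f b. 0)"
  shows "leavitt_class t \<noteq> leavitt_class Zero"
proof
  assume "leavitt_class t = leavitt_class Zero"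
  moreover have "Zero \<in> leavitt_class Zero" by (auto intro: alg_cong.refl)
  ultimately have "(t, Zero) \<in> alg_cong (leavitt_gens G) (leavitt_relations G)" by auto
  then have "alg_eval operators rep t = alg_eval operators rep Zero"
    by (rule algebra.alg_eval_cong[OF algebra_operators rep_image, rotated]) (rule rep_relations)
  with assms show False by simp
qed

text \<open>
  To refute ideal-simplicity, separate a nonzero element from another one by an invariant set of
  operators.
\<close>

lemma not_ideal_simpleI:
  fixes t u :: "('s::semifield, ('v, 'e) leavitt_gen) alg_term"
  assumes J: "J \<subseteq> carrier operators" "(\<lambda>f b. 0) \<in> J"
      "\<And>S T. S \<in> J \<Longrightarrow> T \<in> J \<Longrightarrow> (\<lambda>f b. S f b + T f b) \<in> J"
      "\<And>k T. T \<in> J \<Longrightarrow> (\<lambda>f b. k * T f b) \<in> J"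
      "\<And>x T. x \<in> leavitt_gens G \<Longrightarrow> T \<in> J \<Longrightarrow> (\<lambda>f. rep x (T f)) \<in> J \<and> (\<lambda>f. T (rep x f)) \<in> J"
    and t: "t \<in> alg_terms (leavitt_gens G)" "alg_eval operators rep t \<in> J"
      "leavitt_class t \<noteq> leavitt_class Zero"
    and u: "u \<in> alg_terms (leavitt_gens G)" "alg_eval operators rep u \<notin> J"
  shows "\<not> ideal_simple (leavitt_path_algebra TYPE('s) G)"
proof
  let ?L = "leavitt_path_algebra TYPE('s) G"
  define I where "I = leavitt_class ` {t \<in> alg_terms (leavitt_gens G). alg_eval operators rep t \<in> J}"
  assume simple: "ideal_simple ?L"
  have "zero operators \<in> J" "\<And>S T. S \<in> J \<Longrightarrow> T \<in> J \<Longrightarrow> add operators S T \<in> J"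
      "\<And>k T. T \<in> J \<Longrightarrow> smult operators k T \<in> J"
      "\<And>x T. x \<in> leavitt_gens G \<Longrightarrow> T \<in> J \<Longrightarrow>
        mul operators (rep x) T \<in> J \<and> mul operators T (rep x) \<in> J"
    using J(2-5) by simp_all
  note ideal = ideal_of_representation[where \<R> = "leavitt_relations G", OF algebra_operators rep_image _ J(1) this, folded I_def]
  have "ideal I ?L" unfolding leavitt_path_algebra_def by (rule ideal(1)) (rule rep_relations)
  then have "I \<in> {I. ideal I ?L}" by (rule CollectI)
  then have "I = {zero ?L} \<or> I = carrier ?L"
    unfolding simple[unfolded ideal_simple_def] by simp
  moreover have "leavitt_class t \<in> I" unfolding I_def using t by blast
  moreover have "leavitt_class u \<notin> I" using ideal(2)[OF rep_relations, of u] u by simp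
  moreover have "zero ?L = leavitt_class Zero" "leavitt_class u \<in> carrier ?L"
    unfolding leavitt_path_algebra_def presented_algebra_simps(1,2) using u(1) by (simp, blast)
  ultimately show False using t(3) by (elim disjE) simp_all
qed

lemma rep_vertex_nonzero:
  assumes "v \<notin> H"
  shows "pull (stay v) \<noteq> (\<lambda>(f :: ('v, 'e) state \<Rightarrow> 's::comm_semiring_1) b. 0)"
proof
  assume "pull (stay v) = (\<lambda>(f :: ('v, 'e) state \<Rightarrow> 's) b. 0)"
  then have "pull (stay v) (\<lambda>b. 1 :: 's) ((v, [], 0), 0) = 0" by metis
  then show False using assms by (simp add: pull_def)
qed

lemma rep_vertex_zero: "v \<in> H \<Longrightarrow> pull (stay v) = (\<lambda>f b. 0)"
proof (intro ext)
  fix f :: "('v, 'e) state \<Rightarrow> 's::comm_semiring_1" and b assume "v \<in> H"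
  then show "pull (stay v) f b = 0" by (cases "(v, b)" rule: stay.cases) (auto simp: pull_def)
qed

end

lemma vertex_class_neq_zero:
  assumes "wf_digraph G"
  shows "alg_cong (leavitt_gens G) (leavitt_relations G) `` {Gen (Vertex v)} \<noteq>
    alg_cong (leavitt_gens G) (leavitt_relations G) ``
      {Zero :: ('s::comm_semiring_1, ('v, 'e) leavitt_gen) alg_term}"
proof -
  interpret wf_digraph G by fact
  interpret branching G "{}"
    by unfold_locales (simp_all add: empty_hereditary empty_saturated)
  show ?thesis by (rule class_neq_zero) (simp add: rep_vertex_nonzero)
qed

text \<open>
  The kernel of the representation separates \<open>h\<close> from \<open>v\<close>. That \<open>h\<close> is nonzero is seen in the
  representation that kills no vertex.
\<close>

lemma (in branching) not_ideal_simple_if_nontrivial: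
  assumes "h \<in> H" "h \<in> verts G" "v \<in> verts G" "v \<notin> H"
  shows "\<not> ideal_simple (leavitt_path_algebra TYPE('s::semifield) G)"
proof (rule not_ideal_simpleI[of "{\<lambda>f b. 0}" "Gen (Vertex h)" "Gen (Vertex v)"])
  show "leavitt_class (Gen (Vertex h)) \<noteq> leavitt_class (Zero :: ('s, _) alg_term)"
    by (rule vertex_class_neq_zero) unfold_locales
  show "alg_eval operators rep (Gen (Vertex v)) \<notin> {\<lambda>(f :: ('v, 'e) state \<Rightarrow> 's) b. 0}"
    using rep_vertex_nonzero[OF assms(4)] by simp
qed (use assms in \<open>auto simp: rep_vertex_zero leavitt_gens_def operator_zero intro!: operatorI\<close>)


section \<open>Cycles without exits\<close>

text \<open>
  The functions on the integers that correspond to the multiples of \<open>1 + x\<^sup>n\<close> among the Laurent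
  polynomials.
\<close>

definition multiples :: "int \<Rightarrow> (int \<Rightarrow> 's::comm_semiring_1) set" where
  "multiples n = {q. \<exists>g. finite {m. g m \<noteq> 0} \<and> q = (\<lambda>m. g m + g (m - n))}"

lemma multiplesI: "finite {m. g m \<noteq> 0} \<Longrightarrow> (\<lambda>m. g m + g (m - n)) \<in> multiples n"
  by (auto simp: multiples_def)

lemma multiples_zero: "(\<lambda>m. 0) \<in> multiples n"
  using multiplesI[of "\<lambda>m. 0" n] by simp

lemma multiples_add:
  assumes "p \<in> multiples n" "q \<in> multiples n" shows "(\<lambda>m. p m + q m) \<in> multiples n"
proof -
  obtain g h where g: "finite {m. g m \<noteq> 0}" "p = (\<lambda>m. g m + g (m - n))"
    and h: "finite {m. h m \<noteq> 0}" "q = (\<lambda>m. h m + h (m - n))"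
    using assms by (auto simp: multiples_def)
  have "finite {m. g m + h m \<noteq> 0}"
    by (rule finite_subset[OF _ finite_UnI[OF g(1) h(1)]]) auto
  from multiplesI[OF this, of n] show ?thesis by (simp add: g(2) h(2) ac_simps)
qed

lemma multiples_scale:
  assumes "q \<in> multiples n" shows "(\<lambda>m. k * q m) \<in> multiples n"
proof -
  obtain g where g: "finite {m. g m \<noteq> 0}" "q = (\<lambda>m. g m + g (m - n))"
    using assms by (auto simp: multiples_def)
  have "finite {m. k * g m \<noteq> 0}" by (rule finite_subset[OF _ g(1)]) auto
  from multiplesI[OF this, of n] show ?thesis by (simp add: g(2) distrib_left)
qed

lemma multiples_shift:
  assumes "q \<in> multiples n" shows "(\<lambda>m. q (m + d)) \<in> multiples n"
proof -
  obtain g where g: "finite {m. g m \<noteq> 0}" "q = (\<lambda>m. g m + g (m - n))"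
    using assms by (auto simp: multiples_def)
  have "finite {m. g (m + d) \<noteq> 0}"
    using finite_vimageI[OF g(1), of "\<lambda>m. m + d"] by (simp add: vimage_def inj_def)
  from multiplesI[OF this, of n] show ?thesis by (simp add: g(2) algebra_simps)
qed

text \<open>
  The terms of highest and of lowest degree of a nonzero multiple of \<open>1 + x\<^sup>n\<close> have different
  degrees and arise from a single summand each, so they do not cancel, over any semiring.
\<close>

lemma delta_not_multiple:
  assumes "n > 0"
  shows "(\<lambda>m. if m = 0 then 1 else 0) \<notin> (multiples n :: (int \<Rightarrow> 's::comm_semiring_1) set)"
proof
  assume "(\<lambda>m. if m = 0 then 1 else 0) \<in> (multiples n :: (int \<Rightarrow> 's) set)"
  then obtain g :: "int \<Rightarrow> 's" where fin: "finite {m. g m \<noteq> 0}"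
    and "(\<lambda>m. if m = 0 then 1 else 0) = (\<lambda>m. g m + g (m - n))"
    by (auto simp: multiples_def)
  then have g: "g m + g (m - n) = (if m = 0 then 1 else 0)" for m by metis
  let ?M = "{m. g m \<noteq> 0}"
  have ne: "?M \<noteq> {}"
  proof
    assume "?M = {}"
    then have "g m = 0" for m by auto
    then show False using g[of 0] by simp
  qed
  have "Max ?M + n \<notin> ?M" "Min ?M - n \<notin> ?M"
    using Max_ge[OF fin, of "Max ?M + n"] Min_le[OF fin, of "Min ?M - n"] assms by auto
  moreover have "Max ?M \<in> ?M" "Min ?M \<in> ?M" using Max_in[OF fin ne] Min_in[OF fin ne] by auto
  ultimately have "g (Max ?M + n) + g (Max ?M + n - n) \<noteq> 0" "g (Min ?M) + g (Min ?M - n) \<noteq> 0"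
    by auto
  then have "Max ?M + n = 0" "Min ?M = 0" using g by metis+
  moreover have "Min ?M \<le> Max ?M" using Max_ge[OF fin \<open>Min ?M \<in> ?M\<close>] .
  ultimately show False using assms by simp
qed

definition delta :: "'b \<Rightarrow> 'b \<Rightarrow> 's::comm_semiring_1" where
  "delta b a = (if a = b then 1 else 0)"

text \<open>
  Splitting off the integer component, an operator becomes a matrix whose entries are functions on
  the integers. Here all entries are required to be multiples of \<open>1 + x\<^sup>n\<close>.
\<close>

definition multiple_operators :: "int \<Rightarrow> (('z \<times> int \<Rightarrow> 's) \<Rightarrow> 'z \<times> int \<Rightarrow> 's::comm_semiring_1) set" where
  "multiple_operators n =
    {T \<in> carrier operators. \<forall>b z. (\<lambda>m. T (delta b) (z, m)) \<in> multiples n}"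

lemma multiple_operatorsD:
  "T \<in> multiple_operators n \<Longrightarrow> (\<lambda>m. T (delta b) (z, m)) \<in> multiples n"
  unfolding multiple_operators_def by blast

lemma multiple_operators_pull_left:
  fixes T :: "('z \<times> int \<Rightarrow> 's::comm_semiring_1) \<Rightarrow> 'z \<times> int \<Rightarrow> 's"
  assumes T: "T \<in> multiple_operators n"
    and h: "\<And>z. (\<forall>m. h (z, m) = None) \<or> (\<exists>z' d. \<forall>m. h (z, m) = Some (z', m + d))"
  shows "(\<lambda>f. pull h (T f)) \<in> multiple_operators n"
  unfolding multiple_operators_def
proof (intro CollectI conjI allI)
  interpret algebra operators by (rule algebra_operators)
  show "(\<lambda>f. pull h (T f)) \<in> carrier operators"
    using mul_closed[OF pull_operator, of T h] T by (simp add: multiple_operators_def)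
  fix b z
  consider "\<forall>m. h (z, m) = None" | z' d where "\<forall>m. h (z, m) = Some (z', m + d)" using h by metis
  then show "(\<lambda>m. pull h (T (delta b)) (z, m)) \<in> multiples n"
  proof cases
    case 1
    then show ?thesis by (simp add: pull_def multiples_zero)
  next
    case (2 z' d)
    from multiples_shift[OF multiple_operatorsD[OF T, of b z'], of d] show ?thesis using 2 by (simp add: pull_def)
  qed
qed

lemma multiple_operators_pull_right:
  fixes T :: "('z \<times> int \<Rightarrow> 's::comm_semiring_1) \<Rightarrow> 'z \<times> int \<Rightarrow> 's"
  assumes T: "T \<in> multiple_operators n"
    and h: "\<And>a b c. h a = Some c \<Longrightarrow> h b = Some c \<Longrightarrow> a = b"
  shows "(\<lambda>f. T (pull h f)) \<in> multiple_operators n"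
  unfolding multiple_operators_def
proof (intro CollectI conjI allI)
  interpret algebra operators by (rule algebra_operators)
  have T': "T \<in> carrier operators" using T by (simp add: multiple_operators_def)
  show "(\<lambda>f. T (pull h f)) \<in> carrier operators"
    using mul_closed[OF T' pull_operator, of h] by simp
  fix b z
  have "pull h (delta b) = (\<lambda>b. 0 :: 's) \<or> (\<exists>a. pull h (delta b) = (delta a :: _ \<Rightarrow> 's))"
  proof (cases "\<exists>a. h a = Some b")
    case True
    then obtain a where a: "h a = Some b" by blast
    have "pull h (delta b) = (delta a :: _ \<Rightarrow> 's)"
    proof
      fix c
      have "h c = Some b \<longleftrightarrow> c = a" using a h by metis
      then show "pull h (delta b) c = delta a c"
        by (cases "h c") (simp_all add: pull_def delta_def)
    qed
    then show ?thesis by blast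
  next
    case False
    have "pull h (delta b) = (\<lambda>b. 0 :: 's)"
    proof
      fix c
      have "h c \<noteq> Some b" using False by blast
      then show "pull h (delta b) c = 0" by (cases "h c") (simp_all add: pull_def delta_def)
    qed
    then show ?thesis by blast
  qed
  then show "(\<lambda>m. T (pull h (delta b)) (z, m)) \<in> multiples n"
  proof (elim disjE exE)
    assume "pull h (delta b) = (\<lambda>b. 0 :: 's)"
    then show ?thesis using operator_zero[OF T'] by (simp add: multiples_zero)
  next
    fix a assume "pull h (delta b) = (delta a :: _ \<Rightarrow> 's)"
    then show ?thesis using multiple_operatorsD[OF T, of a z] by simp
  qed
qed

context branching
begin

lemma homogeneous:
  "(\<forall>m. stay v (z, m) = None) \<or> (\<exists>z' d. \<forall>m. stay v (z, m) = Some (z', m + d))"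
  "(\<forall>m. forward e (z, m) = None) \<or> (\<exists>z' d. \<forall>m. forward e (z, m) = Some (z', m + d))"
  "(\<forall>m. backward e (z, m) = None) \<or> (\<exists>z' d. \<forall>m. backward e (z, m) = Some (z', m + d))"
proof -
  obtain u l k where z: "z = (u, l, k)" by (metis prod.exhaust)
  show "(\<forall>m. stay v (z, m) = None) \<or> (\<exists>z' d. \<forall>m. stay v (z, m) = Some (z', m + d))"
    by (auto simp: z intro: exI[of _ 0])
  show "(\<forall>m. forward e (z, m) = None) \<or> (\<exists>z' d. \<forall>m. forward e (z, m) = Some (z', m + d))"
    by (cases "regular_vertex G (tail G e)") (auto simp: z)
  show "(\<forall>m. backward e (z, m) = None) \<or> (\<exists>z' d. \<forall>m. backward e (z, m) = Some (z', m + d))"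
    unfolding z backward.simps diff_conv_add_uminus
    by (cases "regular_vertex G (tail G e)") (auto split: list.splits)
qed

lemma stay_SomeD: "stay v a = Some c \<Longrightarrow> a = c"
  by (cases "(v, a)" rule: stay.cases) (auto split: if_splits)

text \<open>The partial maps of an edge and of its ghost are inverse to each other.\<close>

lemma partially_injective:
  assumes "e \<in> arcs G"
  shows "forward e a = Some c \<Longrightarrow> forward e b = Some c \<Longrightarrow> a = b"
    and "backward e a = Some c \<Longrightarrow> backward e b = Some c \<Longrightarrow> a = b"
proof -
  have "backward e c = Some a" if "forward e a = Some c" for a c
  proof -
    have "stay (head G e) a \<noteq> None"
      using that by (cases "(e, a)" rule: backward.cases) (auto dest: live_tail split: if_splits)
    then show ?thesis using backward_forward[OF assms assms, of a] that stay_SomeD[of "head G e" a] by auto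
  qed
  then show "forward e a = Some c \<Longrightarrow> forward e b = Some c \<Longrightarrow> a = b" by (metis option.inject)
  have "forward e c = Some a" if bw: "backward e a = Some c" for a c
  proof -
    obtain u l k m where a: "a = ((u, l, k), m)" by (metis prod.exhaust)
    show ?thesis
    proof (cases "regular_vertex G (tail G e)")
      case True
      then show ?thesis using forward_backward[OF True, of u l k m] bw
        by (auto simp: a split: if_splits)
    next
      case False
      then show ?thesis using bw by (auto simp: a split: if_splits list.splits)
    qed
  qed
  then show "backward e a = Some c \<Longrightarrow> backward e b = Some c \<Longrightarrow> a = b" by (metis option.inject)
qed

lemma rep_multiple_operators:
  fixes T :: "(('v, 'e) state \<Rightarrow> 's::comm_semiring_1) \<Rightarrow> ('v, 'e) state \<Rightarrow> 's"
  assumes "x \<in> leavitt_gens G" "T \<in> multiple_operators n"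
  shows "(\<lambda>f. rep x (T f)) \<in> multiple_operators n" "(\<lambda>f. T (rep x f)) \<in> multiple_operators n"
proof -
  obtain h where h: "rep x = (pull h :: (('v, 'e) state \<Rightarrow> 's) \<Rightarrow> _)"
      "\<And>z. (\<forall>m. h (z, m) = None) \<or> (\<exists>z' d. \<forall>m. h (z, m) = Some (z', m + d))"
      "\<And>a b c. h a = Some c \<Longrightarrow> h b = Some c \<Longrightarrow> a = b"
    using assms(1) unfolding leavitt_gens_def
  proof (elim UnE imageE)
    fix v assume "x = Vertex v"
    then show thesis by (intro that[OF _ homogeneous(1), of v]) (auto dest!: stay_SomeD)
  next
    fix e assume "x = Edge e" "e \<in> arcs G"
    then show thesis by (intro that[OF _ homogeneous(3) partially_injective(2), of e]) simp_all
  next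
    fix e assume "x = Ghost e" "e \<in> arcs G"
    then show thesis by (intro that[OF _ homogeneous(2) partially_injective(1), of e]) simp_all
  qed
  show "(\<lambda>f. rep x (T f)) \<in> multiple_operators n"
    unfolding h(1) by (rule multiple_operators_pull_left[OF assms(2) h(2)])
  show "(\<lambda>f. T (rep x f)) \<in> multiple_operators n"
    unfolding h(1) by (rule multiple_operators_pull_right[OF assms(2) h(3)])
qed

primrec walk_term :: "'v \<Rightarrow> 'e list \<Rightarrow> ('s, ('v, 'e) leavitt_gen) alg_term" where
  "walk_term u [] = Gen (Vertex u)"
| "walk_term u (e # p) = Times (Gen (Edge e)) (walk_term (head G e) p)"

lemma walk_term_in_alg_terms: "awalk u p w \<Longrightarrow> walk_term u p \<in> alg_terms (leavitt_gens G)"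
  by (induction p arbitrary: u) (auto simp: awalk_simps leavitt_gens_def)

text \<open>
  Along a walk without branching, the copies belonging to its vertices are mapped identically onto
  each other, and only the degree changes.
\<close>

lemma rep_walk_without_branching:
  assumes "awalk u p w" "\<And>e. e \<in> set p \<Longrightarrow> out_arcs G (tail G e) = {e}" "\<And>x. x \<notin> H"
  shows "alg_eval operators rep (walk_term u p :: ('s::comm_semiring_1, ('v, 'e) leavitt_gen) alg_term) =
    pull (\<lambda>((x, y), m). if x = u then Some ((w, y), m - int (length p)) else None)"
  using assms(1,2)
proof (induction p arbitrary: u)
  case Nil
  have "stay w b = (case b of ((x, y), m) \<Rightarrow> if x = w then Some ((w, y), m) else None)" for b
    using assms(3) by (cases "(w, b)" rule: stay.cases) auto
  then show ?case using Nil by (simp add: awalk_simps fun_eq_iff pull_def)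
next
  case (Cons e p)
  have e: "e \<in> arcs G" "u = tail G e" "awalk (head G e) p w" using Cons.prems(1) by (auto simp: awalk_simps)
  have out: "out_arcs G u = {e}" using Cons.prems(2) e(2) by simp
  then have live: "live u = {e}" using assms(3) by (auto simp: live_def)
  have reg: "regular_vertex G u" using out e by (simp add: regular_vertex_def)
  then have index: "index e = 0" using index_less[of e u] live by simp
  have bw: "backward e ((x, l, k), m) = (if x = u then Some ((head G e, l, k), m - 1) else None)"
    for x l k m
    using live reg index e(2) by simp
  have "alg_eval operators rep (walk_term (head G e) p :: ('s, ('v, 'e) leavitt_gen) alg_term) =
    pull (\<lambda>((x, y), m). if x = head G e then Some ((w, y), m - int (length p)) else None)"
    using Cons.IH[OF e(3)] Cons.prems(2) by simp
  then have "alg_eval operators rep (walk_term u (e # p) :: ('s, ('v, 'e) leavitt_gen) alg_term) =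
    (\<lambda>f. pull (backward e) (pull (\<lambda>((x, y), m).
      if x = head G e then Some ((w, y), m - int (length p)) else None) f))" by simp
  also have "\<dots> = pull (\<lambda>((x, y), m). if x = u then Some ((w, y), m - int (length (e # p))) else None)"
  proof (intro ext)
    fix f :: "('v, 'e) state \<Rightarrow> 's" and b :: "('v, 'e) state"
    obtain x l k m where b: "b = ((x, l, k), m)" by (metis prod.exhaust)
    show "pull (backward e) (pull (\<lambda>((x, y), m).
        if x = head G e then Some ((w, y), m - int (length p)) else None) f) b =
      pull (\<lambda>((x, y), m). if x = u then Some ((w, y), m - int (length (e # p))) else None) f b"
      unfolding pull_pull b pull_def bw by (simp add: algebra_simps)
  qed
  finally show ?case .
qed

end

text \<open>
  For a cycle \<open>p\<close> of length \<open>n\<close> based at \<open>v\<close> without exit, the matrix of \<open>v + p\<close> has entries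
  \<open>0\<close> and \<open>1 + x\<^sup>n\<close>, whereas \<open>v\<close> has the entry \<open>1\<close>.
\<close>

lemma not_ideal_simple_if_cycle_without_exit:
  fixes G :: "('v, 'e) pre_digraph"
  assumes "wf_digraph G" "pre_digraph.cycle G p" "\<not> has_exit G p"
  shows "\<not> ideal_simple (leavitt_path_algebra TYPE('s::semifield) G)"
proof -
  interpret wf_digraph G by fact
  interpret branching G "{}"
    by unfold_locales (simp_all add: empty_hereditary empty_saturated)
  obtain v where p: "awalk v p v" "p \<noteq> []" using assms(2) by (auto simp: cycle_def)
  define n where "n = int (length p)"
  have n: "n > 0" using p by (simp add: n_def)
  have v: "v \<in> verts G" using p by auto
  have out: "out_arcs G (tail G e) = {e}" if "e \<in> set p" for e
    using assms(3) that p(1) unfolding has_exit_def by (auto simp: awalk_def)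
  define t :: "('s, _) alg_term" where "t = Plus (Gen (Vertex v)) (walk_term v p)"
  have t: "alg_eval operators rep t f ((x, l, k), m) =
      (if x = v then f ((v, l, k), m) + f ((v, l, k), m - n) else 0)" for f x l k m
    by (simp add: t_def pull_def n_def rep_walk_without_branching[OF p(1) out])
  have t_terms: "t \<in> alg_terms (leavitt_gens G)"
    using walk_term_in_alg_terms[OF p(1)] v by (simp add: t_def leavitt_gens_def)
  note closed = algebra.alg_eval_closed[OF algebra_operators rep_image]
  show ?thesis
  proof (rule not_ideal_simpleI[of "multiple_operators n" t "Gen (Vertex v)"])
    show "multiple_operators n \<subseteq> carrier operators" by (auto simp: multiple_operators_def)
    show "(\<lambda>f b. 0) \<in> multiple_operators n"
      by (simp add: multiple_operators_def multiples_zero operatorI)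
    show "(\<lambda>f b. S f b + T f b) \<in> multiple_operators n"
      if "S \<in> multiple_operators n" "T \<in> multiple_operators n"
      for S T :: "(('v, 'e) state \<Rightarrow> 's) \<Rightarrow> ('v, 'e) state \<Rightarrow> 's"
      using that hemiring.add_closed[OF algebra.axioms(1)[OF algebra_operators], of S T]
      by (simp add: multiple_operators_def multiples_add)
    show "(\<lambda>f b. k * T f b) \<in> multiple_operators n" if "T \<in> multiple_operators n"
      for k and T :: "(('v, 'e) state \<Rightarrow> 's) \<Rightarrow> ('v, 'e) state \<Rightarrow> 's"
      using that algebra.smult_closed[OF algebra_operators, of T k]
      by (simp add: multiple_operators_def multiples_scale)
    show "alg_eval operators rep t \<in> multiple_operators n"
      unfolding multiple_operators_def
    proof (intro CollectI conjI allI closed t_terms)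
      fix b :: "('v, 'e) state" and z :: "'v \<times> 'e list \<times> nat"
      obtain x l k where z: "z = (x, l, k)" by (metis prod.exhaust)
      let ?g = "\<lambda>m. if x = v then delta b ((v, l, k), m) else (0 :: 's)"
      have "finite {m. ?g m \<noteq> 0}"
        by (rule finite_subset[of _ "{snd b}"]) (auto simp: delta_def)
      from multiplesI[OF this, of n]
      show "(\<lambda>m. alg_eval operators rep t (delta b) (z, m)) \<in> multiples n"
        by (cases "x = v") (simp_all add: z t)
    qed
    show "alg_eval operators rep (Gen (Vertex v)) \<notin>
        (multiple_operators n :: ((('v, 'e) state \<Rightarrow> 's) \<Rightarrow> ('v, 'e) state \<Rightarrow> 's) set)"
    proof
      assume "alg_eval operators rep (Gen (Vertex v)) \<in>
        (multiple_operators n :: ((('v, 'e) state \<Rightarrow> 's) \<Rightarrow> ('v, 'e) state \<Rightarrow> 's) set)"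
      then have "(\<lambda>m. pull (stay v) (delta ((v, [], 0), 0)) ((v, [], 0), m)) \<in>
          (multiples n :: (int \<Rightarrow> 's) set)"
        by (auto dest: multiple_operatorsD)
      then have "(\<lambda>m. if m = 0 then 1 else 0) \<in> (multiples n :: (int \<Rightarrow> 's) set)"
        by (simp add: pull_def delta_def)
      then show False using delta_not_multiple[OF n] by blast
    qed
    show "leavitt_class t \<noteq> leavitt_class Zero"
    proof (rule class_neq_zero, rule notI)
      assume "alg_eval operators rep t = (\<lambda>(f :: ('v, 'e) state \<Rightarrow> 's) b. 0)"
      then have "alg_eval operators rep t (delta ((v, [], 0), 0)) ((v, [], 0), 0) = 0" by metis
      then show False using n by (simp add: t delta_def)
    qed
    show "(\<lambda>f. rep x (T f)) \<in> multiple_operators n \<and> (\<lambda>f. T (rep x f)) \<in> multiple_operators n"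
      if "x \<in> leavitt_gens G" "T \<in> multiple_operators n"
      for x and T :: "(('v, 'e) state \<Rightarrow> 's) \<Rightarrow> ('v, 'e) state \<Rightarrow> 's"
      using rep_multiple_operators[OF that] by blast
  qed (use t_terms v in \<open>simp_all add: leavitt_gens_def\<close>)
qed

theorem theorem3p4:
  fixes G :: "('v, 'e) pre_digraph"
  assumes "wf_digraph G"
  shows "ideal_simple (leavitt_path_algebra TYPE('s::semifield) G) \<longleftrightarrow>
    {H. H \<subseteq> verts G \<and> hereditary G H \<and> saturated G H} = {{}, verts G}
    \<and> (\<forall>p. pre_digraph.cycle G p \<longrightarrow> has_exit G p)"
proof
  assume simple: "ideal_simple (leavitt_path_algebra TYPE('s) G)"
  have "H = {} \<or> H = verts G" if H: "H \<subseteq> verts G" "hereditary G H" "saturated G H" for H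
  proof (rule ccontr)
    assume "\<not> (H = {} \<or> H = verts G)"
    then obtain h v where "h \<in> H" "h \<in> verts G" "v \<in> verts G" "v \<notin> H" using H(1) by blast
    moreover have "branching G H" using assms H by (simp add: branching_def branching_axioms_def)
    ultimately show False using branching.not_ideal_simple_if_nontrivial simple by metis
  qed
  moreover have "hereditary G (verts G)" "saturated G (verts G)"
    using wf_digraph.head_in_verts[OF assms]
    by (auto simp: hereditary_def saturated_def regular_vertex_def)
  ultimately have "{H. H \<subseteq> verts G \<and> hereditary G H \<and> saturated G H} = {{}, verts G}"
    using empty_hereditary empty_saturated by blast
  then show "{H. H \<subseteq> verts G \<and> hereditary G H \<and> saturated G H} = {{}, verts G}
      \<and> (\<forall>p. pre_digraph.cycle G p \<longrightarrow> has_exit G p)"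
    using not_ideal_simple_if_cycle_without_exit[OF assms] simple by blast
next
  assume "{H. H \<subseteq> verts G \<and> hereditary G H \<and> saturated G H} = {{}, verts G}
    \<and> (\<forall>p. pre_digraph.cycle G p \<longrightarrow> has_exit G p)"
  then show "ideal_simple (leavitt_path_algebra TYPE('s) G)"
    by (intro leavitt_family.ideal_simple_if[OF leavitt_family_leavitt_path_algebra[OF assms]]) simp_all
qed

end
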